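(* Let $\Bbbk$ be a field of characteristic zero and let $n\ge 1$ be an integer. Then the artinian algebra $A(T_{4,n})$ has the weak Lefschetz property if and only if $n\in\{1,2,3,4,5,6,7,9,10,13\}$.
   Context: For integers $m\ge 3$, $n\ge 1$, the tadpole graph $T_{m,n}$ is the simple graph with vertex set $\{x_1,\dots,x_m,y_1,\dots,y_n\}$ and edges $\{x_i,x_{i+1}\}$ for $1\le i\le m-1$, $\{x_m,x_1\}$ (so the $x_i$ form an $m$-cycle), $\{y_j,y_{j+1}\}$ for $1\le j\le n-1$ (so the $y_j$ form a path), and the bridge $\{x_m,y_1\}$. For a simple graph $G$ on vertices $1,\dots,N$, let $R=\Bbbk[x_1,\dots,x_N]$ be the standard graded polynomial ring, $I(G)=(x_ix_j : \{i,j\}\text{ an edge of }G)$ its edge ideal, and $A(G)=R/\big((x_1^2,\dots,x_N^2)+I(G)\big)$, a standard graded artinian algebra $A=\bigoplus_{j=0}^s [A]_j$. Such an $A$ has the weak Lefschetz property (WLP) if there is a linear form $\ell\in[A]_1$ such that multiplication $\times\ell:[A]_j\to[A]_{j+1}$ is injective or surjective for every $j=0,\dots,s-1$. *)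

theory Defs
  imports "HOL-Library.Poly_Mapping"
begin

text \<open>Polynomials over a field 'k in the variables x_0, x_1, ... ; a monomial is a
finitely supported exponent vector nat =>0 nat, a polynomial is a finitely supported
coefficient function on monomials (multiplication = convolution, from Poly_Mapping).
The polynomial ring R = k[x_1..x_N] of the paper is the subring of polynomials involving
only the variables x_0..x_(N-1) (vertex i of the paper corresponds to index i-1).\<close>

type_synonym 'k mpoly = "(nat \<Rightarrow>\<^sub>0 nat) \<Rightarrow>\<^sub>0 'k"

definition var :: "nat \<Rightarrow> 'k::comm_ring_1 mpoly" where
  "var i = Poly_Mapping.single (Poly_Mapping.single i 1) 1"

definition mdeg :: "(nat \<Rightarrow>\<^sub>0 nat) \<Rightarrow> nat" where
  "mdeg m = (\<Sum>i\<in>Poly_Mapping.keys m. Poly_Mapping.lookup m i)"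

definition in_ring :: "nat \<Rightarrow> 'k::comm_ring_1 mpoly \<Rightarrow> bool" where
  "in_ring N p \<longleftrightarrow> (\<forall>m\<in>Poly_Mapping.keys p. Poly_Mapping.keys m \<subseteq> {..<N})"

definition homog :: "nat \<Rightarrow> nat \<Rightarrow> 'k::comm_ring_1 mpoly \<Rightarrow> bool" where
  "homog N j p \<longleftrightarrow> in_ring N p \<and> (\<forall>m\<in>Poly_Mapping.keys p. mdeg m = j)"

definition ideal_gen :: "nat \<Rightarrow> 'k::comm_ring_1 mpoly set \<Rightarrow> 'k mpoly set" where
  "ideal_gen N Gs = {(\<Sum>g\<in>F. c g * g) | F c. finite F \<and> F \<subseteq> Gs \<and> (\<forall>g\<in>F. in_ring N (c g))}"

text \<open>Graph on vertices 0..N-1 with edge set E (a set of 2-element sets).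
The defining ideal (x_i^2) + I(G) of A(G).\<close>
definition art_ideal :: "'k::comm_ring_1 itself \<Rightarrow> nat \<Rightarrow> nat set set \<Rightarrow> 'k mpoly set" where
  "art_ideal _ N E = ideal_gen N ({var i * var i | i. i < N} \<union> {var i * var j | i j. {i, j} \<in> E})"

text \<open>[A]_j is nonzero iff some element of [R]_j is not in the ideal; s is the top degree.\<close>
definition top_degree :: "'k::comm_ring_1 itself \<Rightarrow> nat \<Rightarrow> nat set set \<Rightarrow> nat" where
  "top_degree K N E = Max {j. \<exists>f::'k mpoly. homog N j f \<and> f \<notin> art_ideal K N E}"

text \<open>Multiplication by l : [A]_j -> [A]_(j+1), where A = R / J, injective / surjective.\<close>
definition mult_inj :: "'k::comm_ring_1 itself \<Rightarrow> nat \<Rightarrow> nat set set \<Rightarrow> 'k mpoly \<Rightarrow> nat \<Rightarrow> bool" where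
  "mult_inj K N E l j \<longleftrightarrow>
     (\<forall>f. homog N j f \<and> l * f \<in> art_ideal K N E \<longrightarrow> f \<in> art_ideal K N E)"

definition mult_surj :: "'k::comm_ring_1 itself \<Rightarrow> nat \<Rightarrow> nat set set \<Rightarrow> 'k mpoly \<Rightarrow> nat \<Rightarrow> bool" where
  "mult_surj K N E l j \<longleftrightarrow>
     (\<forall>g. homog N (Suc j) g \<longrightarrow> (\<exists>f. homog N j f \<and> g - l * f \<in> art_ideal K N E))"

text \<open>A(G) has the weak Lefschetz property (l ranges over [R]_1, whose images are [A]_1).\<close>
definition has_WLP :: "'k::comm_ring_1 itself \<Rightarrow> nat \<Rightarrow> nat set set \<Rightarrow> bool" where
  "has_WLP K N E \<longleftrightarrow> (\<exists>l::'k mpoly. homog N 1 l \<and>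
     (\<forall>j < top_degree K N E. mult_inj K N E l j \<or> mult_surj K N E l j))"

text \<open>Tadpole graph T_{m,n}: x_i (1<=i<=m) is vertex i-1, y_j (1<=j<=n) is vertex m+j-1;
total N = m+n vertices.\<close>
definition tadpole_edges :: "nat \<Rightarrow> nat \<Rightarrow> nat set set" where
  "tadpole_edges m n =
     {{i - 1, i} | i. 1 \<le> i \<and> i \<le> m - 1}
   \<union> {{m - 1, 0}}
   \<union> {{m + j - 1, m + j} | j. 1 \<le> j \<and> j \<le> n - 1}
   \<union> {{m - 1, m}}"

end

theory Submission
  imports Defs
begin

text \<open>
  As a vector space \<open>A(G)\<close> is the space of functions on the independent sets of \<open>G\<close>, and
  multiplication by \<open>l = \<Sum> w\<^sub>v x\<^sub>v\<close> sends \<open>F\<close> to \<open>S \<mapsto> \<Sum>v\<in>S. w\<^sub>v F(S - {v})\<close>.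
  For the path \<open>P\<^sub>n\<close> and \<open>l\<close> the sum of the variables, removing the second vertex gives an
  induction showing that \<open>l\<^sup>r : [A]\<^sub>j \<rightarrow> [A]\<^bsub>j+r\<^esub>\<close> is injective if \<open>n \<ge> 4j + 2r - 1\<close> and surjective
  if \<open>n \<le> 3j + 2r - 1\<close>; since the powers \<open>r - 1\<close>, \<open>r\<close> and \<open>r + 1\<close> interact, all \<open>r\<close> have to be
  treated together. Splitting \<open>T\<^bsub>4,n\<^esub>\<close> at its cubic vertex \<open>x\<^sub>4\<close> reduces it to \<open>P\<^sub>n\<close> with \<open>r = 1, 3\<close>
  and \<open>P\<^bsub>n-1\<^esub>\<close> with \<open>r = 2\<close>: multiplication by \<open>l\<close> in degree \<open>j\<close> is injective if \<open>n \<ge> 4j - 3\<close> and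
  surjective if \<open>n \<le> 3j - 2\<close>.

  If \<open>3j - 1 \<le> n \<le> 4j - 4\<close>, both properties fail for every linear form. A kernel element is a
  product of linear forms, one for \<open>{x\<^sub>1, x\<^sub>3}\<close> and one for each of \<open>j - 1\<close> consecutive blocks of
  three or four vertices covering the path (on a block of four it is
  \<open>w\<^sub>1 x\<^sub>1 + w\<^sub>2 x\<^sub>2 - w\<^sub>3 x\<^sub>3 - w\<^sub>4 x\<^sub>4\<close> unless \<open>w\<^sub>1 = w\<^sub>2 = w\<^sub>3 = 0\<close>). Dually, a functional that
  vanishes on the image is a product over the pairs \<open>{x\<^sub>1, x\<^sub>3}\<close>, \<open>{y\<^sub>1, y\<^sub>2}\<close>, \<open>{y\<^sub>4, y\<^sub>5}\<close>, \<dots>.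
  An \<open>n\<close> without such a gap \<open>j\<close> is one of those listed.
\<close>

section \<open>Multiplication by a linear form on functions of finite sets\<close>

text \<open>The coefficient of a squarefree monomial in \<open>l * f\<close> involves only the
  coefficients of the sets \<open>S - {v}\<close>. Hence \<open>F\<close> may be total on sets, and
  independence enters only through the sets \<open>S\<close> at which the result is
  inspected.\<close>

definition raise :: "(nat \<Rightarrow> 'k) \<Rightarrow> (nat set \<Rightarrow> 'k) \<Rightarrow> nat set \<Rightarrow> 'k::field" where
  "raise w F S = (\<Sum>v\<in>S. w v * F (S - {v}))"

abbreviation up :: "(nat set \<Rightarrow> 'k) \<Rightarrow> nat set \<Rightarrow> 'k::field" where
  "up \<equiv> raise (\<lambda>_. 1)"

lemma raise_empty [simp]: "raise w F {} = 0"
  by (simp add: raise_def)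

lemma raise_add: "raise w (\<lambda>T. F T + G T) S = raise w F S + raise w G S"
  by (simp add: raise_def algebra_simps sum.distrib)

lemma raise_diff: "raise w (\<lambda>T. F T - G T) S = raise w F S - raise w G S"
  by (simp add: raise_def algebra_simps sum_subtractf)

lemma raise_scale: "raise w (\<lambda>T. c * F T) S = c * raise w F S"
  by (simp add: raise_def sum_distrib_left mult.left_commute)

lemma raise_cong:
  assumes "\<And>v. v \<in> S \<Longrightarrow> F (S - {v}) = G (S - {v})"
  shows "raise w F S = raise w G S"
  using assms by (auto simp: raise_def intro: sum.cong)

lemma raise_zero: "(\<And>v. v \<in> S \<Longrightarrow> F (S - {v}) = 0) \<Longrightarrow> raise w F S = 0"
  by (simp add: raise_def)

lemma raise_insert:
  assumes "finite S" "a \<notin> S"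
  shows "raise w F (insert a S) = w a * F S + raise w (\<lambda>T. F (insert a T)) S"
proof -
  have "insert a S - {v} = insert a (S - {v})" if "v \<in> S" for v
    using that assms by auto
  then show ?thesis
    using assms by (simp add: raise_def)
qed

lemma up_pow_add:
  "(up ^^ r) (\<lambda>T. F T + G T) = (\<lambda>S. (up ^^ r) F S + (up ^^ r) G S)"
  by (induction r) (auto simp: raise_add)

lemma up_pow_scale: "(up ^^ r) (\<lambda>T. c * F T) = (\<lambda>S. c * (up ^^ r) F S)"
  by (induction r) (auto simp: raise_scale)

lemma up_pow_cong:
  assumes "finite S" "\<And>T. T \<subseteq> S \<Longrightarrow> card T + r = card S \<Longrightarrow> F T = G T"
  shows "(up ^^ r) F S = (up ^^ r) G S"
  using assms
proof (induction r arbitrary: S)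
  case (Suc r)
  have "(up ^^ r) F (S - {v}) = (up ^^ r) G (S - {v})" if "v \<in> S" for v
  proof (rule Suc.IH)
    fix T assume T: "T \<subseteq> S - {v}" "card T + r = card (S - {v})"
    have "card S = Suc (card (S - {v}))"
      using that Suc.prems(1) by (metis card.remove)
    then show "F T = G T"
      using T by (intro Suc.prems(2)) auto
  qed (use Suc.prems in auto)
  then show ?case
    by (auto intro: raise_cong)
qed simp

lemma up_pow_const_0 [simp]: "(up ^^ r) (\<lambda>_. 0) = (\<lambda>_. 0)"
  by (induction r) (simp_all add: raise_def)

lemma up_pow_zero:
  assumes "finite S" "\<And>T. T \<subseteq> S \<Longrightarrow> card T + r = card S \<Longrightarrow> F T = 0"
  shows "(up ^^ r) F S = 0"
  using up_pow_cong[of S r F "\<lambda>_. 0"] assms by simp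

text \<open>Since \<open>x_a\<close> squares to zero,
  \<open>(x_a + L)^r = L^r + r * x_a * L^(r-1)\<close>, with \<open>L\<close> the sum of the other
  variables. For \<open>r = 0\<close> the factor \<open>of_nat r\<close> annihilates the term with
  the truncated exponent.\<close>

lemma up_pow_insert:
  assumes "finite S" "a \<notin> S"
  shows "(up ^^ r) F (insert a S) =
    (up ^^ r) (\<lambda>T. F (insert a T)) S + of_nat r * (up ^^ (r - 1)) F S"
  using assms
proof (induction r arbitrary: S)
  case (Suc r)
  have "(up ^^ Suc r) F (insert a S) =
      (up ^^ r) F S + up (\<lambda>T. (up ^^ r) F (insert a T)) S"
    using Suc.prems by (simp add: raise_insert)
  also have "up (\<lambda>T. (up ^^ r) F (insert a T)) S =
      up (\<lambda>T. (up ^^ r) (\<lambda>T. F (insert a T)) T + of_nat r * (up ^^ (r - 1)) F T) S"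
    using Suc.prems by (intro raise_cong) (simp add: Suc.IH)
  also have "\<dots> = (up ^^ Suc r) (\<lambda>T. F (insert a T)) S + of_nat r * up ((up ^^ (r - 1)) F) S"
    by (simp add: raise_add raise_scale)
  also have "of_nat r * up ((up ^^ (r - 1)) F) S = of_nat r * (up ^^ r) F S"
    by (cases r) simp_all
  finally show ?case
    by (simp add: algebra_simps)
qed simp

section \<open>Powers of the sum of the variables on a path\<close>

definition path_indep :: "nat \<Rightarrow> nat \<Rightarrow> nat set set" where
  "path_indep a b = {S. S \<subseteq> {a..<b} \<and> (\<forall>i\<in>S. Suc i \<notin> S)}"

lemma path_indep_finite: "S \<in> path_indep a b \<Longrightarrow> finite S"
  by (auto simp: path_indep_def intro: finite_subset)

lemma path_indep_mono: "S \<in> path_indep a b \<Longrightarrow> a' \<le> a \<Longrightarrow> b \<le> b' \<Longrightarrow> S \<in> path_indep a' b'"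
  by (fastforce simp: path_indep_def)

lemma path_indep_subset: "S \<in> path_indep a b \<Longrightarrow> T \<subseteq> S \<Longrightarrow> T \<in> path_indep a b"
  by (auto simp: path_indep_def)

lemma path_indep_notin: "S \<in> path_indep a b \<Longrightarrow> i < a \<Longrightarrow> i \<notin> S"
  by (auto simp: path_indep_def)

lemma path_indep_insert:
  "S \<in> path_indep (c + 2) b \<Longrightarrow> a \<le> c \<Longrightarrow> c < b \<Longrightarrow> insert c S \<in> path_indep a b"
  by (fastforce simp: path_indep_def)

text \<open>The cases follow the second vertex \<open>Suc a\<close>. If it is taken, both its
  neighbours are excluded and the rest lies from \<open>a + 3\<close> on; otherwise \<open>a\<close>
  is isolated and may be added freely to a set from \<open>a + 2\<close> on.\<close>

lemma path_indep_cases: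
  assumes "S \<in> path_indep a b"
  obtains "S \<in> path_indep (a + 2) b"
  | S' where "a < b" "S' \<in> path_indep (a + 2) b" "S = insert a S'"
  | S' where "Suc a < b" "S' \<in> path_indep (a + 3) b" "S = insert (Suc a) S'"
proof -
  have S: "S \<subseteq> {a..<b}" "\<And>i. i \<in> S \<Longrightarrow> Suc i \<notin> S"
    using assms by (auto simp: path_indep_def)
  consider "a \<in> S" | "Suc a \<in> S" | "a \<notin> S" "Suc a \<notin> S"
    by blast
  then show thesis
  proof cases
    case 1
    have "S - {a} \<subseteq> {a + 2..<b}"
    proof
      fix x assume "x \<in> S - {a}"
      moreover from this have "x \<noteq> Suc a"
        using S(2) 1 by auto
      ultimately have "a \<le> x" "x < b" "x \<noteq> a" "x \<noteq> Suc a"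
        using S(1) by auto
      then show "x \<in> {a + 2..<b}"
        by simp
    qed
    then have "S - {a} \<in> path_indep (a + 2) b"
      using S by (auto simp: path_indep_def)
    then show thesis
      using 1 S that(2)[of "S - {a}"] by (auto simp: insert_absorb)
  next
    case 2
    have "S - {Suc a} \<subseteq> {a + 3..<b}"
    proof
      fix x assume x: "x \<in> S - {Suc a}"
      then have "x \<noteq> a" "x \<noteq> a + 2"
        using S(2)[of "Suc a"] S(2)[of a] 2 by auto
      moreover have "a \<le> x" "x < b" "x \<noteq> Suc a"
        using S(1) x by auto
      ultimately show "x \<in> {a + 3..<b}"
        by simp
    qed
    then have "S - {Suc a} \<in> path_indep (a + 3) b"
      using S by (auto simp: path_indep_def)
    then show thesis
      using 2 S that(3)[of "S - {Suc a}"] by (auto simp: insert_absorb)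
  next
    case 3
    have "S \<subseteq> {a + 2..<b}"
    proof
      fix x assume "x \<in> S"
      then have "a \<le> x" "x < b" "x \<noteq> a" "x \<noteq> Suc a"
        using S(1) 3 by auto
      then show "x \<in> {a + 2..<b}"
        by simp
    qed
    then show thesis
      using S that(1) by (auto simp: path_indep_def)
  qed
qed

text \<open>Here \<open>t\<close> is the degree after multiplication. Sets with neither of the first
  two vertices, with \<open>a\<close>, and with \<open>Suc a\<close> give three functions on shorter
  paths, which the induction hypothesis treats with the exponents \<open>r - 1\<close>,
  \<open>r + 1\<close> and \<open>r\<close> respectively.\<close>

lemma path_up_pow_inj:
  fixes F :: "nat set \<Rightarrow> 'k::field_char_0"
  assumes "a + 4 * t \<le> b + 1 + 2 * r"
    and "\<And>S. S \<in> path_indep a b \<Longrightarrow> card S = t \<Longrightarrow> (up ^^ r) F S = 0"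
    and "S \<in> path_indep a b" "card S + r = t"
  shows "F S = 0"
  using assms
proof (induction "b - a" arbitrary: a r t F S rule: less_induct)
  case less
  note bound = less.prems(1) and ker = less.prems(2)
  show ?case
  proof (cases "r = 0 \<or> b \<le> a")
    case True
    then show ?thesis
    proof
      assume "b \<le> a"
      then have "S = {}"
        using less.prems(3) by (auto simp: path_indep_def)
      then show ?thesis
        using bound less.prems(2)[of S] less.prems(3,4) \<open>b \<le> a\<close> by (cases "r = 0") auto
    qed (use less.prems in auto)
  next
    case False
    then have r: "r > 0" and ab: "a < b"
      by auto
    have t: "t \<ge> r"
      using less.prems(4) by simp
    have smaller: "b - (a + 2) < b - a" "b - (a + 3) < b - a"
      using ab by auto
    let ?Fa = "\<lambda>T. F (insert a T)" and ?Fb = "\<lambda>T. F (insert (Suc a) T)"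
    have eq_a: "(up ^^ r) ?Fa T + of_nat r * (up ^^ (r - 1)) F T = 0"
      if "T \<in> path_indep (a + 2) b" "card T = t - 1" for T
    proof -
      have "a \<notin> T" "finite T"
        using that path_indep_notin path_indep_finite by auto
      moreover have "(up ^^ r) F (insert a T) = 0"
        using that ab r t calculation by (intro ker path_indep_insert) auto
      ultimately show ?thesis
        by (simp add: up_pow_insert)
    qed
    \<comment> \<open>Applying \<open>up\<close> to \<open>eq_a\<close> turns its second summand
      into \<open>of_nat r * (up ^^ r) F\<close>, which vanishes. So \<open>?Fa\<close> is killed by
      the power \<open>r + 1\<close>; raising \<open>r\<close> by one and dropping two vertices
      leaves the bound as sharp as before.\<close>
    have Fa: "F (insert a T) = 0" if "T \<in> path_indep (a + 2) b" "card T + Suc r = t" for T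
    proof (rule less.hyps[OF smaller(1), where r = "Suc r" and t = t and F = ?Fa])
      fix T assume T: "T \<in> path_indep (a + 2) b" "card T = t"
      have "up (\<lambda>T. (up ^^ r) ?Fa T + of_nat r * (up ^^ (r - 1)) F T) T = 0"
        using T by (intro raise_zero eq_a path_indep_subset[OF T(1)]) (auto simp: path_indep_finite)
      moreover have "up ((up ^^ (r - 1)) F) T = (up ^^ r) F T"
        using r by (cases r) simp_all
      moreover have "(up ^^ r) F T = 0"
        using T by (intro ker path_indep_mono[OF T(1)]) auto
      ultimately show "(up ^^ Suc r) ?Fa T = 0"
        by (simp add: raise_add raise_scale)
    next
      show "a + 2 + 4 * t \<le> b + 1 + 2 * Suc r"
        using bound by simp
    qed (use that in auto)
    \<comment> \<open>Once \<open>?Fa\<close> vanishes, only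
      \<open>of_nat r * (up ^^ (r - 1)) F\<close> is left in \<open>eq_a\<close>, and characteristic
      zero allows division by \<open>r\<close>.\<close>
    have low: "(up ^^ (r - 1)) F T = 0" if "T \<in> path_indep (a + 2) b" "card T = t - 1" for T
    proof -
      have "(up ^^ r) ?Fa T = 0"
        using that t r
        by (intro up_pow_zero Fa path_indep_subset[OF that(1)]) (auto simp: path_indep_finite)
      then show ?thesis
        using eq_a[OF that] r by simp
    qed
    have F0: "F T = 0" if "T \<in> path_indep (a + 2) b" "card T + r = t" for T
    proof (rule less.hyps[OF smaller(1)])
      show "a + 2 + 4 * (t - 1) \<le> b + 1 + 2 * (r - 1)"
        using bound r t by linarith
    qed (use low that r in auto)
    have Fb: "F (insert (Suc a) T) = 0"
      if "T \<in> path_indep (a + 3) b" "card T + Suc r = t" "Suc a < b" for T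
    proof (rule less.hyps[OF smaller(2), where r = r and t = "t - 1" and F = ?Fb])
      fix T assume T: "T \<in> path_indep (a + 3) b" "card T = t - 1"
      have "Suc a \<notin> T" "finite T"
        using T path_indep_notin path_indep_finite by auto
      moreover have "(up ^^ r) F (insert (Suc a) T) = 0"
        using T that r t calculation by (intro ker path_indep_insert) (auto simp: numeral_3_eq_3)
      moreover have "(up ^^ (r - 1)) F T = 0"
        using T by (intro low path_indep_mono[OF T(1)]) auto
      ultimately show "(up ^^ r) ?Fb T = 0"
        by (simp add: up_pow_insert)
    next
      show "a + 3 + 4 * (t - 1) \<le> b + 1 + 2 * r"
        using bound r t by linarith
    qed (use that in auto)
    from less.prems(3) show ?thesis
    proof (cases rule: path_indep_cases)
      case 1
      then show ?thesis
        using F0 less.prems(4) by blast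
    next
      case (2 S')
      then have "a \<notin> S'" "finite S'"
        using path_indep_notin path_indep_finite by auto
      then show ?thesis
        using 2 Fa[of S'] less.prems(4) by simp
    next
      case (3 S')
      then have "Suc a \<notin> S'" "finite S'"
        using path_indep_notin path_indep_finite by auto
      then show ?thesis
        using 3 Fb[of S'] less.prems(4) by simp
    qed
  qed
qed

text \<open>The elimination for injectivity read backwards: the equations for the three kinds of
  sets are solved with the exponents \<open>r - 1\<close>, \<open>r + 1\<close> and \<open>r\<close>
  on shorter paths.\<close>

lemma path_up_pow_surj:
  fixes G :: "nat set \<Rightarrow> 'k::field_char_0"
  assumes "b - a + r + 1 \<le> 3 * t"
  shows "\<exists>F. \<forall>S\<in>path_indep a b. card S = t \<longrightarrow> (up ^^ r) F S = G S"
  using assms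
proof (induction "b - a" arbitrary: a r t G rule: less_induct)
  case less
  note bound = less.prems
  show ?case
  proof (cases "r = 0 \<or> b \<le> a")
    case True
    then show ?thesis
    proof
      assume "r = 0"
      then show ?thesis
        by (intro exI[of _ G]) simp
    next
      assume "b \<le> a"
      then have "S = {}" if "S \<in> path_indep a b" for S
        using that by (auto simp: path_indep_def)
      then show ?thesis
        using bound by (intro exI[of _ G]) fastforce
    qed
  next
    case False
    then have r: "r > 0" and ab: "a < b"
      by auto
    have smaller: "b - (a + 2) < b - a" "b - (a + 3) < b - a"
      using ab by auto
    \<comment> \<open>Lengths 1 and 2 are separate because the recursion subtracts up to 3 from the
      length, and truncation would spoil its bounds.\<close>
    consider "b - a = 1" | "b - a = 2" | "b - a \<ge> 3"
      using ab by linarith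
    then show ?thesis
    proof cases
      case 1
      then have "{a..<b} = {a}"
        by auto
      then have "S = {} \<or> S = {a}" if "S \<in> path_indep a b" for S
        using that by (auto simp: path_indep_def)
      moreover have "r = 1" if "t = 1"
        using that bound 1 r by simp
      ultimately show ?thesis
        using bound 1 r by (intro exI[of _ "\<lambda>_. G {a}"]) (fastforce simp: raise_def)
    next
      case 2
      then have b: "b = a + 2"
        by simp
      have "card S \<noteq> t" if S: "S \<in> path_indep a b" for S
      proof -
        have "S \<subseteq> {a, Suc a}" "\<not> {a, Suc a} \<subseteq> S"
          using S by (auto simp: path_indep_def b)
        then have "S \<subset> {a, Suc a}"
          by auto
        then have "card S < card {a, Suc a}"
          by (rule psubset_card_mono[rotated]) simp
        then show ?thesis
          using bound 2 r by simp
      qed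
      then show ?thesis
        by blast
    next
      case 3
      have bounds: "b - (a + 2) + (r - 1) + 1 \<le> 3 * (t - 1)" "b - (a + 2) + Suc r + 1 \<le> 3 * t"
        "b - (a + 3) + r + 1 \<le> 3 * (t - 1)"
        using bound 3 r by linarith+
      have t: "t > 0"
        using bound by simp
      \<comment> \<open>\<open>P\<close> alone solves the equation for sets containing
        \<open>a\<close>. Adding \<open>up X\<close> to it and taking \<open>- of_nat r * X\<close>
        on sets with \<open>a\<close> preserves that equation, since the two contributions of
        \<open>X\<close> cancel; \<open>X\<close> is thus free to solve the equation for sets with
        neither vertex. \<open>Fb\<close> is found last, given \<open>F0\<close>.\<close>
      obtain P where P: "\<forall>T\<in>path_indep (a + 2) b. card T = t - 1 \<longrightarrow>
          (up ^^ (r - 1)) P T = G (insert a T) / of_nat r"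
        using less.hyps[OF smaller(1) bounds(1), of "\<lambda>T. G (insert a T) / of_nat r"] by blast
      obtain X where X: "\<forall>T\<in>path_indep (a + 2) b. card T = t \<longrightarrow>
          (up ^^ Suc r) X T = G T - (up ^^ r) P T"
        using less.hyps[OF smaller(1) bounds(2), of "\<lambda>T. G T - (up ^^ r) P T"] by blast
      define F0 where "F0 = (\<lambda>T. P T + up X T)"
      define Fa where "Fa = (\<lambda>T. - of_nat r * X T)"
      obtain Fb where Fb: "\<forall>T\<in>path_indep (a + 3) b. card T = t - 1 \<longrightarrow>
          (up ^^ r) Fb T = G (insert (Suc a) T) - of_nat r * (up ^^ (r - 1)) F0 T"
        using less.hyps[OF smaller(2) bounds(3),
            of "\<lambda>T. G (insert (Suc a) T) - of_nat r * (up ^^ (r - 1)) F0 T"] by blast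
      define F where "F = (\<lambda>S. if a \<in> S then Fa (S - {a}) else
        if Suc a \<in> S then Fb (S - {Suc a}) else F0 S)"
      have F0_pow: "(up ^^ i) F0 T = (up ^^ i) P T + (up ^^ Suc i) X T" for i T
        by (simp add: F0_def up_pow_add funpow_swap1)
      have F_F0: "(up ^^ i) F T = (up ^^ i) F0 T" if "T \<in> path_indep (a + 2) b" for i T
        using that path_indep_notin[OF that]
        by (intro up_pow_cong) (auto simp: F_def path_indep_finite)
      show ?thesis
      proof (intro exI[of _ F] ballI impI)
        fix S assume S: "S \<in> path_indep a b" "card S = t"
        from S(1) show "(up ^^ r) F S = G S"
        proof (cases rule: path_indep_cases)
          case 1
          then show ?thesis
            using X S(2) by (simp add: F_F0 F0_pow)
        next
          case (2 T)
          then have T: "a \<notin> T" "finite T" "Suc a \<notin> T"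
            using path_indep_notin path_indep_finite by auto
          have "(up ^^ r) (\<lambda>T. F (insert a T)) T = (up ^^ r) Fa T"
          proof (rule up_pow_cong)
            fix T' assume "T' \<subseteq> T"
            then have "a \<notin> T'" "Suc a \<notin> T'"
              using T by auto
            then show "F (insert a T') = Fa T'"
              by (simp add: F_def)
          qed (rule T)
          also have "\<dots> = - of_nat r * (up ^^ r) X T"
            by (simp only: Fa_def up_pow_scale)
          finally show ?thesis
            using 2 T S(2) P r by (simp add: up_pow_insert F_F0 F0_pow algebra_simps)
        next
          case (3 T)
          then have T: "a \<notin> T" "finite T" "Suc a \<notin> T"
            using path_indep_notin path_indep_finite by auto
          have "(up ^^ r) (\<lambda>T. F (insert (Suc a) T)) T = (up ^^ r) Fb T"
          proof (rule up_pow_cong)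
            fix T' assume "T' \<subseteq> T"
            then have "a \<notin> T'" "Suc a \<notin> T'"
              using T by auto
            then show "F (insert (Suc a) T') = Fb T'"
              by (simp add: F_def)
          qed (rule T)
          moreover have "T \<in> path_indep (a + 2) b"
            using path_indep_mono[OF 3(2)] by simp
          ultimately show ?thesis
            using 3 T S(2) Fb by (simp add: up_pow_insert F_F0)
        qed
      qed
    qed
  qed
qed

section \<open>The ideal of the algebra of a graph\<close>

definition indep_sets :: "nat \<Rightarrow> nat set set \<Rightarrow> nat set set" where
  "indep_sets N E = {S. S \<subseteq> {..<N} \<and> (\<forall>i\<in>S. \<forall>j\<in>S. {i, j} \<notin> E)}"

lemma indep_sets_finite: "S \<in> indep_sets N E \<Longrightarrow> finite S"
  by (auto simp: indep_sets_def intro: finite_subset)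

definition set_monom :: "nat set \<Rightarrow> (nat \<Rightarrow>\<^sub>0 nat)" where
  "set_monom S = (\<Sum>i\<in>S. Poly_Mapping.single i 1)"

lemma lookup_set_monom:
  "finite S \<Longrightarrow> Poly_Mapping.lookup (set_monom S) i = (if i \<in> S then 1 else 0)"
  by (simp add: set_monom_def lookup_sum lookup_single when_def)

lemma keys_set_monom: "finite S \<Longrightarrow> Poly_Mapping.keys (set_monom S) = S"
  by (auto simp: in_keys_iff lookup_set_monom split: if_splits)

lemma mdeg_set_monom: "finite S \<Longrightarrow> mdeg (set_monom S) = card S"
  by (simp add: mdeg_def keys_set_monom lookup_set_monom)

lemma set_monom_inject:
  "finite S \<Longrightarrow> finite T \<Longrightarrow> set_monom S = set_monom T \<longleftrightarrow> S = T"
  by (metis keys_set_monom)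

lemma set_monom_remove:
  "finite S \<Longrightarrow> v \<in> S \<Longrightarrow> set_monom S = Poly_Mapping.single v 1 + set_monom (S - {v})"
  by (simp add: set_monom_def sum.remove)

lemma lookup_monom_times:
  fixes f :: "'k::comm_ring_1 mpoly"
  shows "Poly_Mapping.lookup (Poly_Mapping.single t c * f) (t + u) = c * Poly_Mapping.lookup f u"
  by (simp add: lookup_mult lookup_single when_mult)

lemma lookup_monom_times_notin:
  fixes f :: "'k::comm_ring_1 mpoly"
  assumes "\<And>u. m \<noteq> t + u"
  shows "Poly_Mapping.lookup (Poly_Mapping.single t c * f) m = 0"
proof -
  have "m \<notin> Poly_Mapping.keys (Poly_Mapping.single t c * f)"
    using keys_mult[of "Poly_Mapping.single t c" f] assms by (auto split: if_splits)
  then show ?thesis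
    by (simp add: in_keys_iff)
qed

lemma var_mult_var:
  "var i * var j = (Poly_Mapping.single (Poly_Mapping.single i 1 + Poly_Mapping.single j 1) 1
    :: 'k::comm_ring_1 mpoly)"
  by (simp add: var_def mult_single)

lemma in_ring_minus:
  "in_ring N p \<Longrightarrow> in_ring N q \<Longrightarrow> in_ring N (p - q)"
  unfolding in_ring_def using keys_diff[of p q] by blast

lemma in_ring_sum:
  "(\<And>x. x \<in> A \<Longrightarrow> in_ring N (f x)) \<Longrightarrow> in_ring N (\<Sum>x\<in>A. f x)"
  unfolding in_ring_def using keys_sum[of f A] by blast

lemma in_ring_mult:
  assumes "in_ring N p" "in_ring N q"
  shows "in_ring N (p * q)"
  unfolding in_ring_def
proof
  fix m assume "m \<in> Poly_Mapping.keys (p * q)"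
  then obtain a b where "m = a + b" "a \<in> Poly_Mapping.keys p" "b \<in> Poly_Mapping.keys q"
    using keys_mult[of p q] by blast
  then show "Poly_Mapping.keys m \<subseteq> {..<N}"
    using assms keys_add[of a b] unfolding in_ring_def by blast
qed

lemma in_ring_single:
  "in_ring N (Poly_Mapping.single m c) \<longleftrightarrow> c = 0 \<or> Poly_Mapping.keys m \<subseteq> {..<N}"
  by (auto simp: in_ring_def)

locale simple_graph =
  fixes N :: nat and E :: "nat set set"
  assumes edge_verts: "{i, j} \<in> E \<Longrightarrow> i < N \<and> j < N \<and> i \<noteq> j"
begin

lemma indep_sets_subset: "S \<in> indep_sets N E \<Longrightarrow> T \<subseteq> S \<Longrightarrow> T \<in> indep_sets N E"
  by (auto simp: indep_sets_def)

lemma monom_split: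
  assumes "Poly_Mapping.keys m \<subseteq> {..<N}" "\<And>S. S \<in> indep_sets N E \<Longrightarrow> m \<noteq> set_monom S"
  obtains i j u where "m = u + (Poly_Mapping.single i 1 + Poly_Mapping.single j 1)"
    "Poly_Mapping.keys u \<subseteq> {..<N}" "i = j \<and> i < N \<or> {i, j} \<in> E"
proof -
  obtain i j where ij: "i = j \<and> i < N \<or> {i, j} \<in> E"
    "\<And>x. Poly_Mapping.lookup (Poly_Mapping.single i (1::nat) + Poly_Mapping.single j 1) x
       \<le> Poly_Mapping.lookup m x"
  proof (cases "\<exists>i. Poly_Mapping.lookup m i \<ge> 2")
    case True
    then obtain i where i: "Poly_Mapping.lookup m i \<ge> 2"
      by blast
    then have "i \<in> Poly_Mapping.keys m"
      by (simp add: in_keys_iff)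
    then show thesis
      using assms(1) i by (intro that[of i i]) (auto simp: lookup_add lookup_single when_def)
  next
    case False
    then have "\<not> 2 \<le> Poly_Mapping.lookup m i" for i
      by blast
    then have le1: "Poly_Mapping.lookup m i \<le> 1" for i
      by (metis Suc_1 not_less_eq_eq)
    have "m = set_monom (Poly_Mapping.keys m)"
    proof (rule poly_mapping_eqI)
      fix x
      show "Poly_Mapping.lookup m x = Poly_Mapping.lookup (set_monom (Poly_Mapping.keys m)) x"
        using le1[of x] by (cases "Poly_Mapping.lookup m x") (auto simp: lookup_set_monom in_keys_iff)
    qed
    then have "Poly_Mapping.keys m \<notin> indep_sets N E"
      using assms(2) by blast
    then obtain i j where e: "i \<in> Poly_Mapping.keys m" "j \<in> Poly_Mapping.keys m" "{i, j} \<in> E"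
      using assms(1) by (auto simp: indep_sets_def)
    show thesis
    proof (rule that[of i j])
      fix x
      show "Poly_Mapping.lookup (Poly_Mapping.single i (1::nat) + Poly_Mapping.single j 1) x
          \<le> Poly_Mapping.lookup m x"
        using e edge_verts[OF e(3)]
        by (auto simp: lookup_add lookup_single when_def in_keys_iff)
    qed (use e in simp)
  qed
  define u where "u = m - (Poly_Mapping.single i 1 + Poly_Mapping.single j 1)"
  have m: "m = u + (Poly_Mapping.single i 1 + Poly_Mapping.single j 1)"
    unfolding u_def using ij(2)
    by (intro poly_mapping_eqI) (metis le_add_diff_inverse2 lookup_add lookup_minus)
  have "Poly_Mapping.keys u \<subseteq> Poly_Mapping.keys m"
    by (auto simp: u_def in_keys_iff lookup_minus)
  then show thesis
    using that m ij(1) assms(1) by blast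
qed

text \<open>The ideal is monomial, so membership is decided term by term: the monomials outside it
  are those of the independent sets, which therefore give a basis of \<open>A(G)\<close>.\<close>

lemma art_ideal_iff:
  fixes p :: "'k::comm_ring_1 mpoly"
  shows "p \<in> art_ideal TYPE('k) N E \<longleftrightarrow>
    in_ring N p \<and> (\<forall>S\<in>indep_sets N E. Poly_Mapping.lookup p (set_monom S) = 0)"
proof
  let ?G = "{var i * var i | i. i < N} \<union> {var i * var j | i j. {i, j} \<in> E} :: 'k mpoly set"
  {
    assume "p \<in> art_ideal TYPE('k) N E"
    then obtain F c where F: "F \<subseteq> ?G" "\<forall>g\<in>F. in_ring N (c g)" "p = (\<Sum>g\<in>F. c g * g)"
      unfolding art_ideal_def ideal_gen_def by blast
    have gen: "\<exists>i j. g = Poly_Mapping.single (Poly_Mapping.single i 1 + Poly_Mapping.single j 1) 1 \<and>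
        i < N \<and> j < N \<and> (i = j \<or> {i, j} \<in> E)" if "g \<in> F" for g
      using that F(1) edge_verts by (auto simp: var_mult_var) blast+
    have "in_ring N g" if g: "g \<in> F" for g
    proof -
      obtain i j where "g = Poly_Mapping.single (Poly_Mapping.single i 1 + Poly_Mapping.single j 1) 1"
        "i < N" "j < N"
        using gen[OF g] by blast
      then show ?thesis
        using keys_add[of "Poly_Mapping.single i (1::nat)" "Poly_Mapping.single j 1"]
        by (auto simp: in_ring_single)
    qed
    then have "in_ring N p"
      unfolding F(3) using F(2) by (intro in_ring_sum in_ring_mult) auto
    moreover have "Poly_Mapping.lookup (c g * g) (set_monom S) = 0"
      if g: "g \<in> F" and S: "S \<in> indep_sets N E" for g S
    proof -
      obtain i j where ij: "g = Poly_Mapping.single (Poly_Mapping.single i 1 + Poly_Mapping.single j 1) 1"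
        "i = j \<or> {i, j} \<in> E"
        using gen[OF g] by blast
      have "set_monom S \<noteq> Poly_Mapping.single i 1 + Poly_Mapping.single j 1 + u" for u
      proof
        assume *: "set_monom S = Poly_Mapping.single i 1 + Poly_Mapping.single j 1 + u"
        have "(if x \<in> S then 1 else 0) = (1 when i = x) + (1 when j = x) + Poly_Mapping.lookup u x" for x
          using arg_cong[OF *, of "\<lambda>m. Poly_Mapping.lookup m x"] S
          by (simp add: lookup_add lookup_single lookup_set_monom indep_sets_finite)
        from this[of i] this[of j] have "i \<in> S" "j \<in> S" "i \<noteq> j"
          by (auto split: if_splits)
        then show False
          using S ij(2) by (auto simp: indep_sets_def)
      qed
      then show ?thesis
        unfolding ij(1) by (subst mult.commute) (rule lookup_monom_times_notin)
    qed
    ultimately show "in_ring N p \<and> (\<forall>S\<in>indep_sets N E. Poly_Mapping.lookup p (set_monom S) = 0)"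
      by (simp add: F(3) lookup_sum)
  }
  {
    assume p: "in_ring N p \<and> (\<forall>S\<in>indep_sets N E. Poly_Mapping.lookup p (set_monom S) = 0)"
    have "\<forall>m\<in>Poly_Mapping.keys p. \<exists>h. fst h + snd h = m \<and>
        Poly_Mapping.keys (fst h) \<subseteq> {..<N} \<and> Poly_Mapping.single (snd h) 1 \<in> ?G"
    proof
      fix m assume m: "m \<in> Poly_Mapping.keys p"
      have "Poly_Mapping.keys m \<subseteq> {..<N}"
        using p m by (auto simp: in_ring_def)
      moreover have "m \<noteq> set_monom S" if "S \<in> indep_sets N E" for S
        using p m that by (auto simp: in_keys_iff)
      ultimately obtain i j u where "m = u + (Poly_Mapping.single i 1 + Poly_Mapping.single j 1)"
        "Poly_Mapping.keys u \<subseteq> {..<N}" "i = j \<and> i < N \<or> {i, j} \<in> E"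
        by (rule monom_split)
      moreover from this(3) have
        "Poly_Mapping.single (Poly_Mapping.single i 1 + Poly_Mapping.single j 1) 1 \<in> ?G"
        unfolding var_mult_var[symmetric] by blast
      ultimately show "\<exists>h. fst h + snd h = m \<and>
          Poly_Mapping.keys (fst h) \<subseteq> {..<N} \<and> Poly_Mapping.single (snd h) 1 \<in> ?G"
        by (intro exI[of _ "(u, Poly_Mapping.single i 1 + Poly_Mapping.single j 1)"]) simp
    qed
    from bchoice[OF this] obtain h where h: "\<forall>m\<in>Poly_Mapping.keys p. fst (h m) + snd (h m) = m \<and>
        Poly_Mapping.keys (fst (h m)) \<subseteq> {..<N} \<and> Poly_Mapping.single (snd (h m)) 1 \<in> ?G" ..
    define u g where "u = fst \<circ> h" and "g = snd \<circ> h"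
    have ug: "u m + g m = m" "Poly_Mapping.keys (u m) \<subseteq> {..<N}" "Poly_Mapping.single (g m) 1 \<in> ?G"
      if "m \<in> Poly_Mapping.keys p" for m
      using h that by (auto simp only: u_def g_def comp_apply)
    let ?K = "Poly_Mapping.keys p" and ?g = "\<lambda>m. Poly_Mapping.single (g m) 1 :: 'k mpoly"
    \<comment> \<open>The sum in \<open>ideal_gen\<close> runs over distinct generators, so the
      terms of \<open>p\<close> assigned to the same generator are collected into one
      coefficient.\<close>
    define c where "c h = (\<Sum>m\<in>{m \<in> ?K. ?g m = h}. Poly_Mapping.single (u m) (Poly_Mapping.lookup p m))"
      for h
    have "p = (\<Sum>m\<in>?K. Poly_Mapping.single m (Poly_Mapping.lookup p m))"
      by (intro poly_mapping_eqI) (auto simp: lookup_sum lookup_single when_def in_keys_iff)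
    also have "\<dots> = (\<Sum>m\<in>?K. Poly_Mapping.single (u m) (Poly_Mapping.lookup p m) * ?g m)"
      by (intro sum.cong) (simp_all add: mult_single ug(1))
    also have "\<dots> = (\<Sum>h\<in>?g ` ?K. \<Sum>m\<in>{m \<in> ?K. ?g m = h}.
        Poly_Mapping.single (u m) (Poly_Mapping.lookup p m) * ?g m)"
      by (rule sum.image_gen) simp
    also have "\<dots> = (\<Sum>h\<in>?g ` ?K. c h * h)"
      unfolding c_def sum_distrib_right by (intro sum.cong refl) simp
    finally have p_eq: "p = (\<Sum>h\<in>?g ` ?K. c h * h)" .
    have c_ring: "in_ring N (c h)" for h
      unfolding c_def using ug(2) by (intro in_ring_sum) (auto simp: in_ring_single)
    have gens: "?g ` ?K \<subseteq> ?G"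
      using ug(3) by blast
    show "p \<in> art_ideal TYPE('k) N E"
      unfolding art_ideal_def ideal_gen_def
      by (intro CollectI exI[of _ "?g ` ?K"] exI[of _ c] conjI ballI p_eq c_ring gens
          finite_imageI finite_keys)
  }
qed

end

section \<open>From multiplication in the algebra to functions on independent sets\<close>

definition linear_weight :: "'k::comm_ring_1 mpoly \<Rightarrow> nat \<Rightarrow> 'k" where
  "linear_weight l v = Poly_Mapping.lookup l (Poly_Mapping.single v 1)"

lemma linear_form_expand:
  fixes l :: "'k::comm_ring_1 mpoly"
  assumes "homog N 1 l"
  shows "l = (\<Sum>v<N. Poly_Mapping.single (Poly_Mapping.single v 1) (linear_weight l v))"
proof (rule poly_mapping_eqI)
  fix m :: "nat \<Rightarrow>\<^sub>0 nat"
  have rhs: "Poly_Mapping.lookup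
      (\<Sum>v<N. Poly_Mapping.single (Poly_Mapping.single v 1) (linear_weight l v)) m =
      (\<Sum>v<N. linear_weight l v when Poly_Mapping.single v 1 = m)"
    by (simp add: lookup_sum lookup_single)
  show "Poly_Mapping.lookup l m = Poly_Mapping.lookup
      (\<Sum>v<N. Poly_Mapping.single (Poly_Mapping.single v 1) (linear_weight l v)) m"
  proof (cases "\<exists>v<N. m = Poly_Mapping.single v 1")
    case True
    then obtain v where v: "v < N" "m = Poly_Mapping.single v 1"
      by blast
    have "Poly_Mapping.single x (1::nat) = m \<longleftrightarrow> x = v" for x
      unfolding v(2) by (metis keys_single one_neq_zero singleton_inject)
    then have "(\<Sum>x<N. linear_weight l x when Poly_Mapping.single x (1::nat) = m) = linear_weight l v"
      using v(1) by (simp add: when_def)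
    moreover have "Poly_Mapping.lookup l m = linear_weight l v"
      by (simp add: v(2) linear_weight_def)
    ultimately show ?thesis
      by (simp only: rhs)
  next
    case False
    have "m \<notin> Poly_Mapping.keys l"
    proof
      assume m: "m \<in> Poly_Mapping.keys l"
      then have "mdeg m = 1" "Poly_Mapping.keys m \<subseteq> {..<N}"
        using assms by (auto simp: homog_def in_ring_def)
      then obtain v where v: "v \<in> Poly_Mapping.keys m" "Poly_Mapping.lookup m v = 1"
        "\<forall>b\<in>Poly_Mapping.keys m. v \<noteq> b \<longrightarrow> Poly_Mapping.lookup m b = 0"
        unfolding mdeg_def by (auto simp: sum_eq_Suc0_iff)
      have "m = Poly_Mapping.single v 1"
        using v by (intro poly_mapping_eqI) (auto simp: lookup_single when_def in_keys_iff)
      then show False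
        using False v(1) \<open>Poly_Mapping.keys m \<subseteq> {..<N}\<close> by auto
    qed
    moreover have "(\<Sum>v<N. linear_weight l v when Poly_Mapping.single v 1 = m) = 0"
      using False by (intro sum.neutral) auto
    ultimately show ?thesis
      unfolding rhs by (simp add: in_keys_iff)
  qed
qed

lemma lookup_linear_times:
  fixes l f :: "'k::field mpoly"
  assumes "homog N 1 l" "S \<subseteq> {..<N}"
  shows "Poly_Mapping.lookup (l * f) (set_monom S) =
    raise (linear_weight l) (\<lambda>T. Poly_Mapping.lookup f (set_monom T)) S"
proof -
  have S: "finite S"
    using assms(2) finite_subset by blast
  let ?t = "\<lambda>v. Poly_Mapping.lookup
    (Poly_Mapping.single (Poly_Mapping.single v 1) (linear_weight l v) * f) (set_monom S)"
  have out: "?t v = 0" if "v \<notin> S" for v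
  proof (rule lookup_monom_times_notin)
    fix u
    show "set_monom S \<noteq> Poly_Mapping.single v 1 + u"
      using that lookup_set_monom[OF S, of v] by (auto simp: lookup_add)
  qed
  have "Poly_Mapping.lookup (l * f) (set_monom S) = (\<Sum>v<N. ?t v)"
    by (subst linear_form_expand[OF assms(1)]) (simp add: sum_distrib_right lookup_sum)
  also have "\<dots> = (\<Sum>v\<in>S. ?t v)"
    using assms(2) out by (intro sum.mono_neutral_right) auto
  also have "\<dots> = raise (linear_weight l) (\<lambda>T. Poly_Mapping.lookup f (set_monom T)) S"
    unfolding raise_def
    by (intro sum.cong) (use S in \<open>auto simp: set_monom_remove lookup_monom_times\<close>)
  finally show ?thesis .
qed

definition set_poly :: "nat set set \<Rightarrow> (nat set \<Rightarrow> 'k) \<Rightarrow> 'k::comm_ring_1 mpoly" where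
  "set_poly A F = (\<Sum>S\<in>A. Poly_Mapping.single (set_monom S) (F S))"

lemma lookup_set_poly:
  assumes "finite A" "\<And>S. S \<in> A \<Longrightarrow> finite S" "finite T"
  shows "Poly_Mapping.lookup (set_poly A F) (set_monom T) = (if T \<in> A then F T else 0)"
proof -
  have "Poly_Mapping.lookup (set_poly A F) (set_monom T) = (\<Sum>S\<in>A. if S = T then F S else 0)"
    unfolding set_poly_def lookup_sum
    using assms by (intro sum.cong) (auto simp: lookup_single when_def set_monom_inject)
  then show ?thesis
    using assms(1) by simp
qed

lemma homog_set_poly:
  assumes "\<And>S. S \<in> A \<Longrightarrow> S \<subseteq> {..<N} \<and> card S = j"
  shows "homog N j (set_poly A F)"
proof -
  have "\<exists>S\<in>A. m = set_monom S" if "m \<in> Poly_Mapping.keys (set_poly A F)" for m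
    using that keys_sum[of "\<lambda>S. Poly_Mapping.single (set_monom S) (F S)" A]
    by (fastforce simp: set_poly_def split: if_splits)
  moreover have "finite S" if "S \<in> A" for S
    using assms[OF that] finite_subset by blast
  ultimately show ?thesis
    using assms unfolding homog_def in_ring_def
    by (metis keys_set_monom mdeg_set_monom)
qed

lemma homog_coeff_eq_0:
  "homog N j f \<Longrightarrow> finite S \<Longrightarrow> card S \<noteq> j \<Longrightarrow> Poly_Mapping.lookup f (set_monom S) = 0"
  by (metis homog_def in_keys_iff mdeg_set_monom)

context simple_graph
begin

lemma finite_indep_sets: "finite (indep_sets N E)"
  by (rule finite_subset[of _ "Pow {..<N}"]) (auto simp: indep_sets_def)

abbreviation "layer j \<equiv> {S \<in> indep_sets N E. card S = j}"

lemma homog_layer: "homog N j (set_poly (layer j) F)"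
  by (rule homog_set_poly) (auto simp: indep_sets_def)

lemma lookup_layer:
  "S \<in> indep_sets N E \<Longrightarrow>
    Poly_Mapping.lookup (set_poly (layer j) F) (set_monom S) = (if card S = j then F S else 0)"
  by (subst lookup_set_poly) (auto simp: finite_indep_sets indep_sets_finite)

lemma lookup_linear_times_indep:
  fixes l f :: "'k::field mpoly"
  assumes "homog N 1 l" "S \<in> indep_sets N E"
  shows "Poly_Mapping.lookup (l * f) (set_monom S) =
    raise (linear_weight l) (\<lambda>T. Poly_Mapping.lookup f (set_monom T)) S"
  using assms by (intro lookup_linear_times) (auto simp: indep_sets_def)

text \<open>Independence passes to subsets, and removing one element lands in
  \<open>layer j\<close>; so the values of \<open>F\<close> that \<open>set_poly\<close> discards
  are never consulted.\<close>

lemma raise_layer: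
  assumes "S \<in> layer (Suc j)"
  shows "raise w (\<lambda>T. Poly_Mapping.lookup (set_poly (layer j) F) (set_monom T)) S = raise w F S"
  using assms indep_sets_subset[of S]
  by (intro raise_cong) (auto simp: lookup_layer indep_sets_finite)

lemma in_ring_linear_times: "homog N 1 l \<Longrightarrow> homog N j f \<Longrightarrow> in_ring N (l * f)"
  by (simp add: homog_def in_ring_mult)

lemma raise_homog_other_degree:
  assumes "homog N j f" "finite S" "card S \<noteq> Suc j"
  shows "raise w (\<lambda>T. Poly_Mapping.lookup f (set_monom T)) S = 0"
proof (rule raise_zero)
  fix v assume v: "v \<in> S"
  then have "card S = Suc (card (S - {v}))"
    using assms(2) by (metis card.remove)
  then show "Poly_Mapping.lookup f (set_monom (S - {v})) = 0"
    using assms by (intro homog_coeff_eq_0) auto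
qed

text \<open>Modulo the ideal, a form of degree \<open>j\<close> is its coefficient function on
  \<open>layer j\<close>. The coefficients of \<open>l * f\<close> at independent sets of other
  sizes than \<open>Suc j\<close> vanish for degree reasons, so the ideal condition reduces to one
  layer.\<close>

lemma mult_inj_iff:
  fixes l :: "'k::field mpoly"
  assumes l: "homog N 1 l"
  shows "mult_inj TYPE('k) N E l j \<longleftrightarrow>
    (\<forall>F. (\<forall>S\<in>layer (Suc j). raise (linear_weight l) F S = 0) \<longrightarrow> (\<forall>S\<in>layer j. F S = 0))"
    (is "_ \<longleftrightarrow> ?R")
proof
  assume inj: "mult_inj TYPE('k) N E l j"
  show ?R
  proof (intro allI impI)
    fix F assume F: "\<forall>S\<in>layer (Suc j). raise (linear_weight l) F S = 0"
    let ?f = "set_poly (layer j) F"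
    have "Poly_Mapping.lookup (l * ?f) (set_monom S) = 0" if S: "S \<in> indep_sets N E" for S
    proof (cases "card S = Suc j")
      case True
      then show ?thesis
        using F S l by (simp add: lookup_linear_times_indep raise_layer)
    next
      case False
      then show ?thesis
        using S l by (simp add: lookup_linear_times_indep raise_homog_other_degree[OF homog_layer]
            indep_sets_finite)
    qed
    then have "l * ?f \<in> art_ideal TYPE('k) N E"
      using in_ring_linear_times[OF l homog_layer] by (auto simp: art_ideal_iff)
    then have "?f \<in> art_ideal TYPE('k) N E"
      using inj homog_layer unfolding mult_inj_def by blast
    then show "\<forall>S\<in>layer j. F S = 0"
      by (auto simp: art_ideal_iff lookup_layer)
  qed
next
  assume R: ?R
  show "mult_inj TYPE('k) N E l j"
    unfolding mult_inj_def
  proof (intro allI impI)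
    fix f assume f: "homog N j f \<and> l * f \<in> art_ideal TYPE('k) N E"
    let ?F = "\<lambda>T. Poly_Mapping.lookup f (set_monom T)"
    have "\<forall>S\<in>layer (Suc j). raise (linear_weight l) ?F S = 0"
      using f l by (auto simp: art_ideal_iff lookup_linear_times_indep)
    then have "\<forall>S\<in>layer j. ?F S = 0"
      using R by blast
    then have "?F S = 0" if "S \<in> indep_sets N E" for S
      using that f homog_coeff_eq_0[of N j f S] indep_sets_finite by (cases "card S = j") auto
    then show "f \<in> art_ideal TYPE('k) N E"
      using f by (auto simp: art_ideal_iff homog_def)
  qed
qed

lemma mult_surj_iff:
  fixes l :: "'k::field mpoly"
  assumes l: "homog N 1 l"
  shows "mult_surj TYPE('k) N E l j \<longleftrightarrow>
    (\<forall>G. \<exists>F. \<forall>S\<in>layer (Suc j). raise (linear_weight l) F S = G S)"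
    (is "_ \<longleftrightarrow> ?R")
proof
  assume surj: "mult_surj TYPE('k) N E l j"
  show ?R
  proof
    fix G :: "nat set \<Rightarrow> 'k"
    let ?g = "set_poly (layer (Suc j)) G"
    obtain f where f: "homog N j f" "?g - l * f \<in> art_ideal TYPE('k) N E"
      using surj homog_layer unfolding mult_surj_def by blast
    have "raise (linear_weight l) (\<lambda>T. Poly_Mapping.lookup f (set_monom T)) S = G S"
      if S: "S \<in> layer (Suc j)" for S
    proof -
      have "Poly_Mapping.lookup (?g - l * f) (set_monom S) = 0"
        using f(2) S by (auto simp: art_ideal_iff)
      then show ?thesis
        using S l by (simp add: lookup_minus lookup_layer lookup_linear_times_indep)
    qed
    then show "\<exists>F. \<forall>S\<in>layer (Suc j). raise (linear_weight l) F S = G S"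
      by blast
  qed
next
  assume R: ?R
  show "mult_surj TYPE('k) N E l j"
    unfolding mult_surj_def
  proof (intro allI impI)
    fix g :: "'k mpoly" assume g: "homog N (Suc j) g"
    obtain F where F: "\<forall>S\<in>layer (Suc j). raise (linear_weight l) F S =
        Poly_Mapping.lookup g (set_monom S)"
      using R[rule_format, of "\<lambda>T. Poly_Mapping.lookup g (set_monom T)"] by blast
    let ?f = "set_poly (layer j) F"
    have "Poly_Mapping.lookup (g - l * ?f) (set_monom S) = 0" if S: "S \<in> indep_sets N E" for S
    proof (cases "card S = Suc j")
      case True
      then show ?thesis
        using F S l by (simp add: lookup_minus lookup_linear_times_indep raise_layer)
    next
      case False
      then show ?thesis
        using S l homog_coeff_eq_0[OF g]
        by (simp add: lookup_minus lookup_linear_times_indep raise_homog_other_degree[OF homog_layer]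
            indep_sets_finite)
    qed
    moreover have "in_ring N (g - l * ?f)"
      using g l homog_layer by (intro in_ring_minus in_ring_linear_times) (auto simp: homog_def)
    ultimately show "\<exists>f. homog N j f \<and> g - l * f \<in> art_ideal TYPE('k) N E"
      using homog_layer by (auto simp: art_ideal_iff)
  qed
qed

text \<open>\<open>Max\<close> needs a finite set, so the degrees of nonzero components are first
  shown to be sizes of independent sets. The bound later certifies that a degree where both
  properties fail is one that \<open>has_WLP\<close> tests.\<close>

lemma card_le_top_degree:
  assumes "S \<in> indep_sets N E"
  shows "card S \<le> top_degree TYPE('k::field) N E"
proof -
  let ?D = "{j. \<exists>f::'k mpoly. homog N j f \<and> f \<notin> art_ideal TYPE('k) N E}"
  have "?D \<subseteq> card ` indep_sets N E"
  proof
    fix j assume "j \<in> ?D"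
    then obtain f :: "'k mpoly" where f: "homog N j f" "f \<notin> art_ideal TYPE('k) N E"
      by blast
    then obtain T where "T \<in> indep_sets N E" "Poly_Mapping.lookup f (set_monom T) \<noteq> 0"
      by (auto simp: art_ideal_iff homog_def)
    then show "j \<in> card ` indep_sets N E"
      using homog_coeff_eq_0[OF f(1)] indep_sets_finite by blast
  qed
  then have "finite ?D"
    using finite_indep_sets finite_surj by blast
  moreover have "set_poly (layer (card S)) (\<lambda>_. 1 :: 'k) \<notin> art_ideal TYPE('k) N E"
    using assms by (auto simp: art_ideal_iff lookup_layer intro!: bexI[of _ S])
  then have "card S \<in> ?D"
    using homog_layer by blast
  ultimately show ?thesis
    unfolding top_degree_def by (rule Max_ge)
qed

end

section \<open>The tadpole with a four-cycle, for the sum of the variables\<close>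

text \<open>The tadpole is the path \<open>0, ..., N - 1\<close>, which runs once around the cycle
  and then along the tail, together with the single chord \<open>{0, 3}\<close>.\<close>

definition tadpole_indep :: "nat \<Rightarrow> nat set set" where
  "tadpole_indep N = {S \<in> path_indep 0 N. \<not> (0 \<in> S \<and> 3 \<in> S)}"

lemma tadpole_edges_4:
  assumes "n \<ge> 1"
  shows "tadpole_edges 4 n = {{i, Suc i} | i. Suc i < 4 + n} \<union> {{0, 3}}"
proof -
  have "{{i - 1, i} | i::nat. 1 \<le> i \<and> i \<le> 4 - 1} = {{i, Suc i} | i. i < 3}"
  proof (intro equalityI subsetI)
    fix e assume "e \<in> {{i - 1, i} | i::nat. 1 \<le> i \<and> i \<le> 4 - 1}"
    then obtain i where "e = {i - 1, i}" "1 \<le> i" "i \<le> 3"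
      by auto
    then show "e \<in> {{i, Suc i} | i. i < 3}"
      by (intro CollectI exI[of _ "i - 1"]) auto
  next
    fix e :: "nat set" assume "e \<in> {{i, Suc i} | i. i < 3}"
    then obtain i where "e = {i, Suc i}" "i < 3"
      by blast
    then show "e \<in> {{i - 1, i} | i::nat. 1 \<le> i \<and> i \<le> 4 - 1}"
      by (intro CollectI exI[of _ "Suc i"]) auto
  qed
  moreover have "{{4 + j - 1, 4 + j} | j::nat. 1 \<le> j \<and> j \<le> n - 1} =
      {{i, Suc i} | i. 4 \<le> i \<and> Suc i < 4 + n}"
  proof (intro equalityI subsetI)
    fix e assume "e \<in> {{4 + j - 1, 4 + j} | j::nat. 1 \<le> j \<and> j \<le> n - 1}"
    then obtain j where "e = {4 + j - 1, 4 + j}" "1 \<le> j" "j \<le> n - 1"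
      by blast
    then show "e \<in> {{i, Suc i} | i. 4 \<le> i \<and> Suc i < 4 + n}"
      by (intro CollectI exI[of _ "3 + j"]) auto
  next
    fix e assume "e \<in> {{i, Suc i} | i. 4 \<le> i \<and> Suc i < 4 + n}"
    then obtain i where "e = {i, Suc i}" "4 \<le> i" "Suc i < 4 + n"
      by blast
    then show "e \<in> {{4 + j - 1, 4 + j} | j::nat. 1 \<le> j \<and> j \<le> n - 1}"
      by (intro CollectI exI[of _ "i - 3"]) auto
  qed
  moreover have "{{i, Suc i} | i. Suc i < 4 + n} = {{i, Suc i} | i. i < 3} \<union>
      {{i, Suc i} | i. 4 \<le> i \<and> Suc i < 4 + n} \<union> {{3, 4}}"
  proof -
    have *: "{i. Suc i < 4 + n} = {i. i < 3} \<union> {i. 4 \<le> i \<and> Suc i < 4 + n} \<union> {3}"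
      using assms by auto
    show ?thesis
      unfolding setcompr_eq_image * image_Un by simp
  qed
  ultimately show ?thesis
    unfolding tadpole_edges_def by (simp add: Un_ac insert_commute)
qed

lemma tadpole_edge_iff:
  assumes "n \<ge> 1"
  shows "{i, j} \<in> tadpole_edges 4 n \<longleftrightarrow>
    j = Suc i \<and> j < 4 + n \<or> i = Suc j \<and> i < 4 + n \<or> {i, j} = {0, 3}"
  unfolding tadpole_edges_4[OF assms] by (auto simp: doubleton_eq_iff)

lemma simple_graph_tadpole: "n \<ge> 1 \<Longrightarrow> simple_graph (4 + n) (tadpole_edges 4 n)"
  by unfold_locales (auto simp: tadpole_edge_iff doubleton_eq_iff)

lemma indep_sets_tadpole:
  assumes "n \<ge> 1"
  shows "indep_sets (4 + n) (tadpole_edges 4 n) = tadpole_indep (4 + n)"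
proof -
  have "(\<forall>i\<in>S. \<forall>j\<in>S. {i, j} \<notin> tadpole_edges 4 n) \<longleftrightarrow>
      (\<forall>i\<in>S. Suc i \<notin> S) \<and> \<not> (0 \<in> S \<and> 3 \<in> S)" if "S \<subseteq> {..<4 + n}" for S
  proof
    assume *: "\<forall>i\<in>S. \<forall>j\<in>S. {i, j} \<notin> tadpole_edges 4 n"
    have "Suc i \<notin> S" if "i \<in> S" for i
      using *[rule_format, of i "Suc i"] that \<open>S \<subseteq> {..<4 + n}\<close>
      by (auto simp: tadpole_edge_iff[OF assms])
    moreover have "\<not> (0 \<in> S \<and> 3 \<in> S)"
      using *[rule_format, of 0 3] by (auto simp: tadpole_edge_iff[OF assms])
    ultimately show "(\<forall>i\<in>S. Suc i \<notin> S) \<and> \<not> (0 \<in> S \<and> 3 \<in> S)"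
      by blast
  next
    assume "(\<forall>i\<in>S. Suc i \<notin> S) \<and> \<not> (0 \<in> S \<and> 3 \<in> S)"
    then show "\<forall>i\<in>S. \<forall>j\<in>S. {i, j} \<notin> tadpole_edges 4 n"
      by (auto simp: tadpole_edge_iff[OF assms] doubleton_eq_iff intro!: gr0I)
  qed
  then show ?thesis
    unfolding indep_sets_def tadpole_indep_def path_indep_def
    by (auto simp: lessThan_atLeast0[symmetric] atLeast0LessThan)
qed

text \<open>The cases follow the cubic vertex \<open>3\<close>. Without it, the path on
  \<open>0, 1, 2\<close> contributes one of its five independent sets; with it, \<open>0\<close>,
  \<open>2\<close> and \<open>4\<close> are excluded and only \<open>1\<close> remains
  optional.\<close>

lemma tadpole_indep_cases:
  assumes "S \<in> tadpole_indep N"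
  obtains "S \<in> path_indep 4 N"
  | i T where "i \<in> {0, 1, 2}" "T \<in> path_indep 4 N" "S = insert i T"
  | T where "T \<in> path_indep 4 N" "S = insert 0 (insert 2 T)"
  | T where "T \<in> path_indep 5 N" "S = insert 3 T"
  | T where "T \<in> path_indep 5 N" "S = insert 1 (insert 3 T)"
proof -
  have two: "T \<in> path_indep 4 N \<or> (\<exists>U\<in>path_indep 4 N. T = insert 2 U) \<or>
      (\<exists>U\<in>path_indep 5 N. T = insert 3 U)" if "T \<in> path_indep 2 N" for T
    using that by (cases rule: path_indep_cases) (auto simp: eval_nat_numeral)
  have three: "T \<in> path_indep 4 N \<or> (\<exists>U\<in>path_indep 5 N. T = insert 3 U)" if "T \<in> path_indep 3 N" for T
    using that
  proof (cases rule: path_indep_cases)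
    case 1
    then show ?thesis
      using path_indep_mono[OF 1, of 4 N] by auto
  next
    case (2 S')
    then show ?thesis
      by auto
  next
    case (3 S')
    then show ?thesis
      using path_indep_insert[of S' 4 N 4] by auto
  qed
  have S: "S \<in> path_indep 0 N" "\<not> (0 \<in> S \<and> 3 \<in> S)"
    using assms by (auto simp: tadpole_indep_def)
  from S(1) show thesis
  proof (cases rule: path_indep_cases)
    case 1
    then have "S \<in> path_indep 2 N"
      by (simp add: numeral_2_eq_2)
    then show thesis
      using two[of S] that(1) that(2)[of 2] that(4) by blast
  next
    case (2 T)
    then have "T \<in> path_indep 2 N"
      by (simp add: numeral_2_eq_2)
    from two[OF this] show thesis
    proof (elim disjE bexE)
      assume "T \<in> path_indep 4 N"
      then show thesis
        using that(2)[of 0 T] 2(3) by simp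
    next
      fix U assume "U \<in> path_indep 4 N" "T = insert 2 U"
      then show thesis
        using that(3)[of U] 2(3) by simp
    qed (use 2(3) S(2) in simp)
  next
    case (3 T)
    then have "T \<in> path_indep 3 N" "S = insert 1 T"
      by (simp_all add: numeral_3_eq_3)
    then show thesis
      using three[of T] that(2)[of 1 T] that(5) by blast
  qed
qed

lemma tadpole_indep_intros:
  assumes "N \<ge> 4"
  shows "T \<in> path_indep 4 N \<Longrightarrow> T \<in> tadpole_indep N"
    "T \<in> path_indep 4 N \<Longrightarrow> i \<in> {0, 1, 2} \<Longrightarrow> insert i T \<in> tadpole_indep N"
    "T \<in> path_indep 4 N \<Longrightarrow> insert 0 (insert 2 T) \<in> tadpole_indep N"
    "T \<in> path_indep 5 N \<Longrightarrow> insert 3 T \<in> tadpole_indep N"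
    "T \<in> path_indep 5 N \<Longrightarrow> insert 1 (insert 3 T) \<in> tadpole_indep N"
  using assms by (fastforce simp: tadpole_indep_def path_indep_def)+

lemma path_4_notin: "T \<in> path_indep 4 N \<Longrightarrow> 0 \<notin> T \<and> 1 \<notin> T \<and> 2 \<notin> T \<and> 3 \<notin> T"
  by (auto simp: path_indep_def)

lemma path_5_le: "T \<in> path_indep 5 N \<Longrightarrow> T \<in> path_indep 4 N"
  by (erule path_indep_mono) auto

lemma raise_insert2:
  assumes "finite T" "a \<notin> T" "b \<notin> T" "a \<noteq> b"
  shows "raise w F (insert a (insert b T)) =
    w a * F (insert b T) + (w b * F (insert a T) + raise w (\<lambda>T. F (insert a (insert b T))) T)"
  using assms by (simp add: raise_insert)

lemma raise_path_cong:
  assumes "T \<in> path_indep a b"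
    and "\<And>T'. T' \<in> path_indep a b \<Longrightarrow> Suc (card T') = card T \<Longrightarrow> F T' = G T'"
  shows "raise w F T = raise w G T"
proof (rule raise_cong)
  fix v assume "v \<in> T"
  then show "F (T - {v}) = G (T - {v})"
    using assms path_indep_subset[OF assms(1), of "T - {v}"] path_indep_finite[OF assms(1)]
    by (metis Diff_subset card.remove)
qed

text \<open>The equations for sets without \<open>3\<close> are reduced to the cube of
  \<open>up\<close> killing \<open>?F02\<close> on the path from \<open>4\<close>; those with
  \<open>3\<close> are then reduced to the square killing \<open>?F13\<close> on the path from
  \<open>5\<close>. The uses of path injectivity with \<open>r = 1\<close> and \<open>r = 3\<close>
  exhaust the bound exactly.\<close>

lemma tadpole_up_inj:
  fixes F :: "nat set \<Rightarrow> 'k::field_char_0"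
  assumes N: "N \<ge> 4" "4 * j \<le> N - 1"
    and ker: "\<And>S. S \<in> tadpole_indep N \<Longrightarrow> card S = Suc j \<Longrightarrow> up F S = 0"
    and S: "S \<in> tadpole_indep N" "card S = j"
  shows "F S = 0"
proof -
  let ?P = "path_indep 4 N" and ?Q = "path_indep 5 N"
  let ?F = "\<lambda>i T. F (insert i T)"
  let ?F02 = "\<lambda>T. F (insert 0 (insert 2 T))" and ?F13 = "\<lambda>T. F (insert 1 (insert 3 T))"
  note intros = tadpole_indep_intros[OF N(1)]
  have card_insert: "card (insert i T) = Suc (card T)" if "T \<in> ?P" "i \<in> {0, 1, 2, 3}" for i T
    using that path_4_notin[OF that(1)] path_indep_finite[OF that(1)] by auto
  have card_insert2: "card (insert 0 (insert 2 T)) = card T + 2" "card (insert 1 (insert 3 T)) = card T + 2"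
    if "T \<in> ?P" for T
    using path_4_notin[OF that(1)] path_indep_finite[OF that(1)] by auto
  have e0: "up F T = 0" if "T \<in> ?P" "card T = Suc j" for T
    using that by (intro ker intros(1))
  have e1: "F T + up (?F i) T = 0" if "T \<in> ?P" "card T = j" "i \<in> {0, 1, 2}" for T i
  proof -
    have "up F (insert i T) = 0"
      using that card_insert[OF that(1)] by (intro ker intros(2)) auto
    then show ?thesis
      using that path_4_notin[OF that(1)] path_indep_finite[OF that(1)] by (auto simp: raise_insert)
  qed
  have e02: "?F 2 T + (?F 0 T + up ?F02 T) = 0" if "T \<in> ?P" "card T + 1 = j" for T
  proof -
    have "up F (insert 0 (insert 2 T)) = 0"
      using that card_insert2[OF that(1)] by (intro ker intros(3)) auto
    then show ?thesis
      using path_4_notin[OF that(1)] path_indep_finite[OF that(1)] by (simp add: raise_insert2)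
  qed
  have e3: "F T + up (?F 3) T = 0" if "T \<in> ?Q" "card T = j" for T
  proof -
    have "up F (insert 3 T) = 0"
      using that card_insert[OF path_5_le[OF that(1)]] by (intro ker intros(4)) auto
    then show ?thesis
      using path_4_notin[OF path_5_le[OF that(1)]] path_indep_finite[OF that(1)]
      by (auto simp: raise_insert)
  qed
  have e13: "?F 3 T + (?F 1 T + up ?F13 T) = 0" if "T \<in> ?Q" "card T + 1 = j" for T
  proof -
    have "up F (insert 1 (insert 3 T)) = 0"
      using that card_insert2[OF path_5_le[OF that(1)]] by (intro ker intros(5)) auto
    then show ?thesis
      using path_4_notin[OF path_5_le[OF that(1)]] path_indep_finite[OF that(1)]
      by (simp add: raise_insert2)
  qed
  \<comment> \<open>The functions for \<open>0\<close>, \<open>1\<close> and \<open>2\<close> all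
    have the image \<open>- F\<close> under \<open>up\<close>, so their differences vanish by
    injectivity for \<open>r = 1\<close>.\<close>
  have eq1: "?F i T = ?F 1 T" if "T \<in> ?P" "card T + 1 = j" "i \<in> {0, 2}" for i T
  proof -
    have "?F i T - ?F 1 T = 0"
    proof (rule path_up_pow_inj[where a = 4 and b = N and r = 1 and t = j
          and F = "\<lambda>T. ?F i T - ?F 1 T"])
      fix T assume "T \<in> ?P" "card T = j"
      then have "F T + up (?F i) T = 0" "F T + up (?F 1) T = 0"
        using e1 that(3) by auto
      then have "up (?F i) T = up (?F 1) T"
        by (metis add_left_imp_eq)
      then show "(up ^^ 1) (\<lambda>T. ?F i T - ?F 1 T) T = 0"
        by (simp add: raise_diff)
    qed (use that N in auto)
    then show ?thesis
      by simp
  qed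
  have up1: "up ?F02 T = - 2 * ?F 1 T" if "T \<in> ?P" "card T + 1 = j" for T
  proof -
    have "up ?F02 T = - (?F 2 T + ?F 0 T)"
      unfolding eq_neg_iff_add_eq_0 using e02[OF that] by (simp only: ac_simps)
    also have "\<dots> = - (?F 1 T + ?F 1 T)"
      using eq1[OF that, of 0] eq1[OF that, of 2] by simp
    finally show ?thesis
      by simp
  qed
  have up2: "up (up ?F02) T = 2 * F T" if T: "T \<in> ?P" "card T = j" for T
  proof -
    have "up (up ?F02) T = up (\<lambda>T. - 2 * ?F 1 T) T"
      using up1 T by (intro raise_path_cong[OF T(1)]) auto
    also have "\<dots> = - 2 * up (?F 1) T"
      by (rule raise_scale)
    also have "up (?F 1) T = - F T"
      unfolding eq_neg_iff_add_eq_0 using e1[OF T, of 1] by (simp add: add.commute)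
    finally show ?thesis
      by simp
  qed
  \<comment> \<open>The relations express \<open>?F 1\<close> and then \<open>F\<close> through
    \<open>?F02\<close>; the last one, \<open>e0\<close>, makes its third image zero, in degree
    \<open>Suc j\<close>.\<close>
  have F02: "?F02 T = 0" if "T \<in> ?P" "card T + 2 = j" for T
  proof (rule path_up_pow_inj[where a = 4 and b = N and r = 3 and t = "Suc j"
        and F = ?F02])
    fix T assume T: "T \<in> ?P" "card T = Suc j"
    have "up (up (up ?F02)) T = up (\<lambda>T. 2 * F T) T"
      using up2 T by (intro raise_path_cong[OF T(1)]) auto
    also have "\<dots> = 0"
      using e0[OF T] by (simp add: raise_scale)
    finally show "(up ^^ 3) ?F02 T = 0"
      by (simp add: numeral_3_eq_3)
  qed (use that N in auto)
  have F1: "?F 1 T = 0" if T: "T \<in> ?P" "card T + 1 = j" for T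
  proof -
    have "up ?F02 T = up (\<lambda>_. 0) T"
      using F02 T by (intro raise_path_cong[OF T(1)]) auto
    then have "up ?F02 T = 0"
      by (simp add: raise_def)
    then show ?thesis
      using up1[OF T] by simp
  qed
  have F0: "F T = 0" if T: "T \<in> ?P" "card T = j" for T
  proof -
    have "up (?F 1) T = up (\<lambda>_. 0) T"
      using F1 T by (intro raise_path_cong[OF T(1)]) auto
    then show ?thesis
      using e1[OF T, of 1] by (simp add: raise_def)
  qed
  have g: "?F 3 T = - up ?F13 T" if T: "T \<in> ?Q" "card T + 1 = j" for T
    unfolding eq_neg_iff_add_eq_0 using e13[OF T] F1[OF path_5_le[OF T(1)] T(2)] by simp
  have F13: "?F13 T = 0" if "T \<in> ?Q" "card T + 2 = j" for T
  proof (rule path_up_pow_inj[where a = 5 and b = N and r = 2 and t = j and F = ?F13])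
    fix T assume T: "T \<in> ?Q" "card T = j"
    have "up (?F 3) T = up (\<lambda>T. - 1 * up ?F13 T) T"
      using g T by (intro raise_path_cong[OF T(1)]) auto
    then have "up (?F 3) T = - 1 * up (up ?F13) T"
      by (simp only: raise_scale)
    then show "(up ^^ 2) ?F13 T = 0"
      using e3[OF T] F0[OF path_5_le[OF T(1)] T(2)] by (simp add: numeral_2_eq_2)
  qed (use that N in auto)
  have F3: "?F 3 T = 0" if T: "T \<in> ?Q" "card T + 1 = j" for T
  proof -
    have "up ?F13 T = up (\<lambda>_. 0) T"
      using F13 T by (intro raise_path_cong[OF T(1)]) auto
    then show ?thesis
      using g[OF T] by (simp add: raise_def)
  qed
  from S(1) show ?thesis
  proof (cases rule: tadpole_indep_cases)
    case 1
    then show ?thesis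
      using F0 S(2) by simp
  next
    case (2 i T)
    then have "card T + 1 = j"
      using card_insert[of T i] S(2) by auto
    then show ?thesis
      using 2 F1[of T] eq1[of T i] by auto
  next
    case (3 T)
    then show ?thesis
      using F02[of T] card_insert2[of T] S(2) by auto
  next
    case (4 T)
    then show ?thesis
      using F3[of T] card_insert[OF path_5_le[of T], of 3] S(2) by auto
  next
    case (5 T)
    then show ?thesis
      using F13[of T] card_insert2[OF path_5_le[of T]] S(2) by auto
  qed
qed

text \<open>The same elimination run backwards, with path surjectivity for \<open>r = 1\<close> and
  \<open>r = 3\<close> from \<open>4\<close> on and for \<open>r = 2\<close> from \<open>5\<close>
  on.\<close>

lemma tadpole_up_surj:
  fixes G :: "nat set \<Rightarrow> 'k::field_char_0"
  assumes N: "N \<ge> 5" "N - 2 \<le> 3 * j"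
  shows "\<exists>F. \<forall>S\<in>tadpole_indep N. card S = Suc j \<longrightarrow> up F S = G S"
proof -
  let ?P = "path_indep 4 N" and ?Q = "path_indep 5 N"
  have P1: "\<exists>F. \<forall>T\<in>?P. card T = j \<longrightarrow> up F T = H T" for H :: "nat set \<Rightarrow> 'k"
    using path_up_pow_surj[of N 4 1 j H] N by auto
  have P3: "\<exists>F. \<forall>T\<in>?P. card T = Suc j \<longrightarrow> up (up (up F)) T = H T" for H :: "nat set \<Rightarrow> 'k"
    using path_up_pow_surj[of N 4 3 "Suc j" H] N by (auto simp: numeral_3_eq_3)
  have Q2: "\<exists>F. \<forall>T\<in>?Q. card T = j \<longrightarrow> up (up F) T = H T" for H :: "nat set \<Rightarrow> 'k"
    using path_up_pow_surj[of N 5 2 j H] N by (auto simp: numeral_2_eq_2)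
  \<comment> \<open>This keeps \<open>insert 1 T\<close> from being rewritten to
    \<open>insert (Suc 0) T\<close>, so that the equations below still match.\<close>
  note One_nat_def [simp del]
  obtain u0 u1 u2 where
    u0: "\<And>T. T \<in> ?P \<Longrightarrow> card T = j \<Longrightarrow> up u0 T = G (insert 0 T)" and
    u1: "\<And>T. T \<in> ?P \<Longrightarrow> card T = j \<Longrightarrow> up u1 T = G (insert 1 T)" and
    u2: "\<And>T. T \<in> ?P \<Longrightarrow> card T = j \<Longrightarrow> up u2 T = G (insert 2 T)"
    using P1[of "\<lambda>T. G (insert 0 T)"] P1[of "\<lambda>T. G (insert 1 T)"] P1[of "\<lambda>T. G (insert 2 T)"]
    by metis
  \<comment> \<open>The ansatz takes \<open>up v\<close> on sets without \<open>0, 1, 2, 3\<close>,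
    and \<open>u0 - v\<close>, \<open>u1 - v\<close>, \<open>u2 - v\<close> when just that vertex is
    added; the equations for a single such vertex then hold for every \<open>v\<close>. The pair
    \<open>{0, 2}\<close> forces \<open>2 * v = d + up X\<close>, and the sets with none of these
    vertices require the cube equation for \<open>X\<close>.\<close>
  define d where "d = (\<lambda>T. u0 T + u2 T - G (insert 0 (insert 2 T)))"
  obtain X where X: "\<And>T. T \<in> ?P \<Longrightarrow> card T = Suc j \<Longrightarrow>
      up (up (up X)) T = 2 * G T - up (up d) T"
    using P3[of "\<lambda>T. 2 * G T - up (up d) T"] by metis
  define v where "v = (\<lambda>T. 1 / 2 * (d T + up X T))"
  define f1 where "f1 = (\<lambda>T. u1 T - v T)"
  \<comment> \<open>The equation for the pair \<open>{1, 3}\<close> forces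
    \<open>g = h - up Y\<close>, and the one for \<open>3\<close> alone becomes the square equation
    for \<open>Y\<close>.\<close>
  define h where "h = (\<lambda>T. G (insert 1 (insert 3 T)) - f1 T)"
  obtain Y where Y: "\<And>T. T \<in> ?Q \<Longrightarrow> card T = j \<Longrightarrow>
      up (up Y) T = up h T + up v T - G (insert 3 T)"
    using Q2[of "\<lambda>T. up h T + up v T - G (insert 3 T)"] by metis
  define g where "g = (\<lambda>T. h T - up Y T)"
  define F where "F = (\<lambda>S.
    if 3 \<in> S then if 1 \<in> S then Y (S - {1, 3}) else g (S - {3})
    else if 0 \<in> S then if 2 \<in> S then X (S - {0, 2}) else u0 (S - {0}) - v (S - {0})
    else if 1 \<in> S then f1 (S - {1})
    else if 2 \<in> S then u2 (S - {2}) - v (S - {2}) else up v S)"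
  have F_eq: "F T = up v T" "F (insert 0 T) = u0 T - v T" "F (insert 1 T) = f1 T"
    "F (insert 2 T) = u2 T - v T" "F (insert 3 T) = g T"
    "F (insert 0 (insert 2 T)) = X T" "F (insert 1 (insert 3 T)) = Y T" if "T \<in> ?P" for T
  proof -
    have "0 \<notin> T" "1 \<notin> T" "2 \<notin> T" "3 \<notin> T"
      using path_4_notin[OF that] by auto
    moreover from this have "insert 0 (insert 2 T) - {0, 2} = T" "insert 1 (insert 3 T) - {1, 3} = T"
      by auto
    ultimately show "F T = up v T" "F (insert 0 T) = u0 T - v T" "F (insert 1 T) = f1 T"
      "F (insert 2 T) = u2 T - v T" "F (insert 3 T) = g T"
      "F (insert 0 (insert 2 T)) = X T" "F (insert 1 (insert 3 T)) = Y T"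
      by (simp_all add: F_def)
  qed
  have up_eq: "up (\<lambda>T. F (A \<union> T)) T = up F' T"
    if "T \<in> ?P" "\<And>T. T \<in> ?P \<Longrightarrow> F (A \<union> T) = F' T" for A F' T
    using that by (intro raise_path_cong[OF that(1)]) auto
  have up_F: "up F T = up (up v) T" "up (\<lambda>T. F (insert 0 T)) T = up u0 T - up v T"
    "up (\<lambda>T. F (insert 1 T)) T = up u1 T - up v T" "up (\<lambda>T. F (insert 2 T)) T = up u2 T - up v T"
    "up (\<lambda>T. F (insert 3 T)) T = up h T - up (up Y) T"
    "up (\<lambda>T. F (insert 0 (insert 2 T))) T = up X T" "up (\<lambda>T. F (insert 1 (insert 3 T))) T = up Y T"
    if "T \<in> ?P" for T
    using up_eq[OF that, of "{}" "up v"] up_eq[OF that, of "{0}" "\<lambda>T. u0 T - v T"]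
      up_eq[OF that, of "{1}" f1] up_eq[OF that, of "{2}" "\<lambda>T. u2 T - v T"]
      up_eq[OF that, of "{3}" g] up_eq[OF that, of "{0, 2}" X] up_eq[OF that, of "{1, 3}" Y]
    by (simp_all add: F_eq raise_diff f1_def g_def)
  have notin: "0 \<notin> T" "1 \<notin> T" "2 \<notin> T" "3 \<notin> T" "finite T" if "T \<in> ?P" for T
    using path_4_notin[OF that] path_indep_finite[OF that] by auto
  have "up F S = G S" if S: "S \<in> tadpole_indep N" "card S = Suc j" for S
    using S(1)
  proof (cases rule: tadpole_indep_cases)
    case 1
    have "up (up v) S = 1 / 2 * (up (up d) S + up (up (up X)) S)"
      unfolding v_def raise_scale raise_add ..
    then show ?thesis
      using X[OF 1 S(2)] up_F(1)[OF 1] by simp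
  next
    case (2 i T)
    then have "card T = j"
      using S(2) notin[OF 2(2)] by auto
    then show ?thesis
      using 2 notin[OF 2(2)] u0[OF 2(2)] u1[OF 2(2)] u2[OF 2(2)]
      by (auto simp: raise_insert F_eq up_F)
  next
    case (3 T)
    then show ?thesis
      using notin[OF 3(1)]
      by (simp add: raise_insert2 F_eq up_F v_def d_def field_simps)
  next
    case (4 T)
    note T = path_5_le[OF 4(1)]
    have "card T = j"
      using 4 S(2) notin[OF T] by auto
    then show ?thesis
      using 4 notin[OF T] Y[of T] by (simp add: raise_insert F_eq[OF T] up_F[OF T])
  next
    case (5 T)
    note T = path_5_le[OF 5(1)]
    show ?thesis
      using 5 notin[OF T] by (simp add: raise_insert2 F_eq[OF T] up_F[OF T] g_def h_def)
  qed
  then show ?thesis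
    by blast
qed

section \<open>Kernel elements and obstructions for arbitrary linear forms\<close>

text \<open>The linear form is the sum of its parts on \<open>A\<close> and off \<open>A\<close>,
  and each part acts on one factor. Consequently a product of kernel elements on complementary
  vertex sets is a kernel element.\<close>

lemma raise_product:
  assumes "finite S"
  shows "raise w (\<lambda>S. f (S \<inter> A) * g (S - A)) S =
    raise w f (S \<inter> A) * g (S - A) + f (S \<inter> A) * raise w g (S - A)"
proof -
  let ?t = "\<lambda>v. w v * (f ((S - {v}) \<inter> A) * g (S - {v} - A))"
  have "raise w (\<lambda>S. f (S \<inter> A) * g (S - A)) S = sum ?t (S \<inter> A \<union> (S - A))"
    unfolding raise_def by (simp add: Int_Diff_Un)
  also have "\<dots> = sum ?t (S \<inter> A) + sum ?t (S - A)"
    using assms by (intro sum.union_disjoint) auto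
  also have "sum ?t (S \<inter> A) = (\<Sum>v\<in>S \<inter> A. w v * f (S \<inter> A - {v}) * g (S - A))"
  proof (intro sum.cong refl)
    fix v assume "v \<in> S \<inter> A"
    then have "(S - {v}) \<inter> A = S \<inter> A - {v}" "S - {v} - A = S - A"
      by auto
    then show "?t v = w v * f (S \<inter> A - {v}) * g (S - A)"
      by simp
  qed
  also have "sum ?t (S - A) = (\<Sum>v\<in>S - A. f (S \<inter> A) * (w v * g (S - A - {v})))"
  proof (intro sum.cong refl)
    fix v assume "v \<in> S - A"
    then have "(S - {v}) \<inter> A = S \<inter> A" "S - {v} - A = S - A - {v}"
      by auto
    then show "?t v = f (S \<inter> A) * (w v * g (S - A - {v}))"
      by simp
  qed
  finally show ?thesis
    by (simp add: raise_def sum_distrib_left sum_distrib_right)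
qed

text \<open>The linear form with coefficients \<open>a\<close>, seen as a function on sets; such
  forms are the factors of the kernel elements.\<close>

definition on_singletons :: "(nat \<Rightarrow> 'k) \<Rightarrow> nat set \<Rightarrow> 'k::field" where
  "on_singletons a S = (if card S = 1 then a (the_elem S) else 0)"

lemma raise_on_singletons_pair:
  "u \<noteq> v \<Longrightarrow> raise w (on_singletons a) {u, v} = w u * a v + w v * a u"
  by (simp add: raise_def on_singletons_def insert_Diff_if)

lemma raise_on_singletons_eq_0:
  assumes "finite S" "card S \<noteq> 2"
  shows "raise w (on_singletons a) S = 0"
proof (rule raise_zero)
  fix v assume "v \<in> S"
  then have "card (S - {v}) \<noteq> 1"
    using assms by (simp add: card_Diff_singleton)
  then show "on_singletons a (S - {v}) = 0"
    by (simp add: on_singletons_def)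
qed

text \<open>The nonzero coefficient is sought off the last vertex of the block, so that vertices
  chosen in consecutive blocks are never adjacent.\<close>

lemma path_block_kernel:
  fixes w :: "nat \<Rightarrow> 'k::field"
  assumes b: "b = 3 \<or> b = 4"
  obtains a p where "\<And>S. S \<in> path_indep s (s + b) \<Longrightarrow> raise w (on_singletons a) S = 0"
    "s \<le> p" "Suc p < s + b" "a p \<noteq> 0"
proof -
  obtain a p where a: "\<And>u v. s \<le> u \<Longrightarrow> u + 2 \<le> v \<Longrightarrow> v < s + b \<Longrightarrow> w u * a v + w v * a u = 0"
    and p: "s \<le> p" "Suc p < s + b" "a p \<noteq> 0"
  proof (cases "\<exists>p. s \<le> p \<and> Suc p < s + b \<and> w p \<noteq> 0")
    case True
    then obtain p where p: "s \<le> p" "Suc p < s + b" "w p \<noteq> 0"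
      by blast
    \<comment> \<open>An independent pair in a block of at most four vertices has one vertex among
      the first two and one among the others. Reversing the sign of \<open>w\<close> on the latter
      makes the two products cancel.\<close>
    define a where "a v = (if v < s + 2 then w v else - w v)" for v
    show thesis
    proof (rule that[of a p])
      fix u v assume "s \<le> u" "u + 2 \<le> v" "v < s + b"
      then have "u < s + 2" "\<not> v < s + 2"
        using b by auto
      then show "w u * a v + w v * a u = 0"
        by (simp add: a_def)
    qed (use p in \<open>auto simp: a_def\<close>)
  next
    case False
    \<comment> \<open>Here \<open>w\<close> vanishes on the block except possibly at the last
      vertex. That vertex is a neighbour of the last but one, whose variable alone is therefore a
      kernel element.\<close>
    define a :: "nat \<Rightarrow> 'k" where "a v = (if v = s + b - 2 then 1 else 0)" for v
    show thesis
    proof (rule that[of a "s + b - 2"])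
      fix u v assume uv: "s \<le> u" "u + 2 \<le> v" "v < s + b"
      then have "w u = 0" "u \<noteq> s + b - 2"
        using False by auto
      then show "w u * a v + w v * a u = 0"
        by (simp add: a_def)
    qed (use b in \<open>auto simp: a_def\<close>)
  qed
  have "raise w (on_singletons a) S = 0" if S: "S \<in> path_indep s (s + b)" for S
  proof (cases "card S = 2")
    case True
    then obtain u v where uv: "S = {u, v}" "u < v"
      by (metis card_2_iff insert_commute nat_neq_iff)
    then have "s \<le> u" "u + 2 \<le> v" "v < s + b"
      using S by (auto simp: path_indep_def Suc_le_eq)
    then show ?thesis
      using a uv by (simp add: raise_on_singletons_pair)
  next
    case False
    then show ?thesis
      using S by (simp add: raise_on_singletons_eq_0 path_indep_finite)
  qed
  then show thesis
    using that p by blast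
qed

text \<open>The product of one linear form per block, for a division of the path into
  \<open>q\<close> blocks of three or four vertices; the two inequalities say that such a division
  exists.\<close>

lemma path_kernel:
  fixes w :: "nat \<Rightarrow> 'k::field"
  assumes "s + 3 * q \<le> e" "e \<le> s + 4 * q"
  shows "\<exists>F. (\<forall>S\<in>path_indep s e. raise w F S = 0) \<and>
    (\<exists>S\<in>path_indep s (e - 1). card S = q \<and> F S \<noteq> 0)"
  using assms
proof (induction q arbitrary: s)
  case 0
  then have "e = s"
    by simp
  then have "raise w (\<lambda>_. 1) S = 0" if "S \<in> path_indep s e" for S
    using that by (simp add: path_indep_def)
  moreover have "{} \<in> path_indep s (e - 1)"
    by (simp add: path_indep_def)
  ultimately show ?case
    by (metis card.empty zero_neq_one)
next
  case (Suc q)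
  \<comment> \<open>A block of four is split off unless fewer than three vertices per remaining
    block would be left; in that case \<open>e = s + 3 + 3 * q\<close>, and all blocks have
    three.\<close>
  define b where "b = (if e < s + 4 + 3 * q then 3 else 4 :: nat)"
  have b: "b = 3 \<or> b = 4"
    by (simp add: b_def)
  have bounds: "s + b + 3 * q \<le> e" "e \<le> s + b + 4 * q"
    using Suc.prems by (auto simp: b_def)
  obtain F' S' where F': "\<And>S. S \<in> path_indep (s + b) e \<Longrightarrow> raise w F' S = 0"
    and S': "S' \<in> path_indep (s + b) (e - 1)" "card S' = q" "F' S' \<noteq> 0"
    using Suc.IH[OF bounds] by blast
  obtain a p where a: "\<And>S. S \<in> path_indep s (s + b) \<Longrightarrow> raise w (on_singletons a) S = 0"
    and p: "s \<le> p" "Suc p < s + b" "a p \<noteq> 0"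
    using path_block_kernel[OF b] by metis
  let ?A = "{..<s + b}"
  let ?F = "\<lambda>S. on_singletons a (S \<inter> ?A) * F' (S - ?A)"
  have "raise w ?F S = 0" if S: "S \<in> path_indep s e" for S
  proof -
    have "S \<inter> ?A \<in> path_indep s (s + b)" "S - ?A \<in> path_indep (s + b) e"
      using S by (auto simp: path_indep_def)
    then show ?thesis
      using a F' path_indep_finite[OF S] by (simp add: raise_product)
  qed
  moreover have p_less: "x > Suc p" if "x \<in> S'" for x
    using S'(1) that p(2) by (auto simp: path_indep_def)
  have split: "insert p S' \<inter> ?A = {p}" "insert p S' - ?A = S'"
    using S'(1) p by (auto simp: path_indep_def)
  have "?F (insert p S') \<noteq> 0"
    unfolding split using p S' by (simp add: on_singletons_def)
  moreover have "insert p S' \<in> path_indep s (e - 1)"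
  proof (rule path_indep_insert)
    show "S' \<in> path_indep (p + 2) (e - 1)"
      using S'(1) p_less by (auto simp: path_indep_def Suc_le_eq)
  qed (use p bounds in auto)
  moreover have "card (insert p S') = Suc q"
  proof -
    have "p \<notin> S'"
      using p_less[of p] by auto
    then show ?thesis
      using S'(2) path_indep_finite[OF S'(1)] by simp
  qed
  ultimately show ?case
    by blast
qed

lemma exists_opposite_weights:
  fixes x y :: "'k::field"
  obtains c d where "x * d + y * c = 0" "c \<noteq> 0 \<or> d \<noteq> 0"
  \<comment> \<open>\<open>of\<close> fills \<open>d\<close> before \<open>c\<close>, so the pairs
    \<open>(c, d)\<close> are \<open>(0, 1)\<close> for \<open>x = 0\<close> and
    \<open>(x, - y)\<close> otherwise.\<close>
  using that[of 1 0] that[of "- y" x] by (cases "x = 0") (auto simp: mult.commute)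

text \<open>The path element is multiplied by a linear form in the variables \<open>0\<close> and
  \<open>2\<close>, neither of which is adjacent to the tail. The only independent pairs of the
  four-cycle are \<open>{0, 2}\<close>, where the form is chosen to cancel, and
  \<open>{1, 3}\<close>, where it is zero.\<close>

lemma tadpole_kernel:
  fixes w :: "nat \<Rightarrow> 'k::field"
  assumes "3 * q \<le> n" "n \<le> 4 * q"
  shows "\<exists>F. (\<forall>S\<in>tadpole_indep (4 + n). raise w F S = 0) \<and>
    (\<exists>S\<in>tadpole_indep (4 + n). card S = Suc q \<and> F S \<noteq> 0)"
proof -
  have "\<exists>F. (\<forall>S\<in>path_indep 4 (4 + n). raise w F S = 0) \<and>
      (\<exists>S\<in>path_indep 4 (4 + n - 1). card S = q \<and> F S \<noteq> 0)"
    by (rule path_kernel) (use assms in auto)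
  then obtain F' S' where F': "\<And>S. S \<in> path_indep 4 (4 + n) \<Longrightarrow> raise w F' S = 0"
    and S'_lt: "S' \<in> path_indep 4 (4 + n - 1)" and S'_card: "card S' = q" "F' S' \<noteq> 0"
    by blast
  have S': "S' \<in> path_indep 4 (4 + n)" "card S' = q" "F' S' \<noteq> 0"
    using path_indep_mono[OF S'_lt, of 4 "4 + n"] S'_card by auto
  obtain c d where cd: "w 0 * d + w 2 * c = 0" "c \<noteq> 0 \<or> d \<noteq> 0"
    by (rule exists_opposite_weights)
  define a :: "nat \<Rightarrow> 'k" where "a = (\<lambda>_. 0)(0 := c, 2 := d)"
  obtain p where p: "p = 0 \<or> p = 2" "a p \<noteq> 0"
    using cd(2) that[of 0] that[of 2] by (cases "c = 0") (simp_all add: a_def)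
  let ?A = "{..<4::nat}"
  let ?F = "\<lambda>S. on_singletons a (S \<inter> ?A) * F' (S - ?A)"
  have "raise w ?F S = 0" if S: "S \<in> tadpole_indep (4 + n)" for S
  proof -
    have fin: "finite S"
      using S by (auto simp: tadpole_indep_def path_indep_finite)
    have "raise w (on_singletons a) (S \<inter> ?A) = 0"
    proof (cases "card (S \<inter> ?A) = 2")
      case True
      then obtain u v where uv: "S \<inter> ?A = {u, v}" "u < v"
        by (metis card_2_iff insert_commute nat_neq_iff)
      then have "u \<in> S" "v \<in> S" "u < 4" "v < 4"
        by auto
      then have "v \<noteq> Suc u" "\<not> (u = 0 \<and> v = 3)"
        using S by (auto simp: tadpole_indep_def path_indep_def)
      then have "u = 0 \<and> v = 2 \<or> u = 1 \<and> v = 3"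
        using uv(2) \<open>v < 4\<close> by linarith
      then have "raise w (on_singletons a) {u, v} = 0"
        using cd(1) by (auto simp: raise_on_singletons_pair a_def)
      then show ?thesis
        by (simp only: uv(1))
    next
      case False
      then show ?thesis
        using fin by (simp add: raise_on_singletons_eq_0)
    qed
    moreover have "S - ?A \<in> path_indep 4 (4 + n)"
      using S by (auto simp: tadpole_indep_def path_indep_def)
    ultimately show ?thesis
      using fin F' by (simp add: raise_product)
  qed
  moreover have split: "insert p S' \<inter> ?A = {p}" "insert p S' - ?A = S'"
    using S'(1) p(1) by (auto simp: path_indep_def)
  have "?F (insert p S') \<noteq> 0"
    unfolding split using p S' by (simp add: on_singletons_def)
  moreover have "insert p S' \<in> tadpole_indep (4 + n)"
    using p by (intro tadpole_indep_intros(2)[OF _ S'(1)]) auto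
  moreover have "card (insert p S') = Suc q"
    using p S' path_4_notin[OF S'(1)] path_indep_finite[OF S'(1)] by auto
  ultimately show ?thesis
    by blast
qed

text \<open>Failure of surjectivity is phrased for an arbitrary family of target sets because it
  passes to larger families: it suffices to obstruct a subfamily of product shape.\<close>

definition obstructed :: "(nat \<Rightarrow> 'k::field) \<Rightarrow> nat set set \<Rightarrow> bool" where
  "obstructed w X \<longleftrightarrow> (\<exists>G. \<forall>F. \<exists>S\<in>X. raise w F S \<noteq> G S)"

lemma obstructed_mono: "obstructed w X \<Longrightarrow> X \<subseteq> Y \<Longrightarrow> obstructed w Y"
  unfolding obstructed_def by blast

lemma obstructed_empty_set: "obstructed w {{}}"
  unfolding obstructed_def by (rule exI[of _ "\<lambda>_. 1"]) simp

text \<open>If \<open>w p + c * w q = 0\<close> and \<open>F\<close> solved the extended problem, then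
  \<open>F (insert p S) + c * F (insert q S)\<close> would solve the one for \<open>X\<close>.\<close>

lemma obstructed_insert_pair:
  fixes w :: "nat \<Rightarrow> 'k::field"
  assumes "obstructed w X" "p \<noteq> q" "\<And>S. S \<in> X \<Longrightarrow> finite S \<and> p \<notin> S \<and> q \<notin> S"
  shows "obstructed w (insert p ` X \<union> insert q ` X)"
proof -
  have main: "obstructed w (insert p ` X \<union> insert q ` X)"
    if c: "w p + c * w q = 0" and pq: "p \<noteq> q"
      and X: "\<And>S. S \<in> X \<Longrightarrow> finite S \<and> p \<notin> S \<and> q \<notin> S" for p q c
  proof -
    obtain G where G: "\<And>F. \<exists>S\<in>X. raise w F S \<noteq> G S"
      using assms(1) unfolding obstructed_def by blast
    show ?thesis
      unfolding obstructed_def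
    proof (rule exI[of _ "\<lambda>S. if p \<in> S then G (S - {p}) else 0"], rule allI, rule ccontr)
      fix F
      let ?G = "\<lambda>S. if p \<in> S then G (S - {p}) else 0"
      assume "\<not> (\<exists>S\<in>insert p ` X \<union> insert q ` X. raise w F S \<noteq> ?G S)"
      then have F: "raise w F (insert p S) = ?G (insert p S)"
        "raise w F (insert q S) = ?G (insert q S)" if "S \<in> X" for S
        using that by blast+
      obtain S where S: "S \<in> X"
        "raise w (\<lambda>T. F (insert p T) + c * F (insert q T)) S \<noteq> G S"
        using G by blast
      have "raise w F (insert p S) + c * raise w F (insert q S) = G S"
        using F[OF S(1)] X[OF S(1)] pq by simp
      moreover have "raise w F (insert p S) + c * raise w F (insert q S) =
          (w p + c * w q) * F S + raise w (\<lambda>T. F (insert p T) + c * F (insert q T)) S"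
        using X[OF S(1)] by (simp add: raise_insert raise_add raise_scale algebra_simps)
      ultimately show False
        using S(2) c by simp
    qed
  qed
  show ?thesis
  proof (cases "w q = 0")
    case True
    then show ?thesis
      using main[of q 0 p] assms(2,3) by (auto simp: Un_commute)
  next
    case False
    then show ?thesis
      using main[of p "- w p / w q" q] assms(2,3) by auto
  qed
qed

text \<open>The subfamily takes one vertex from each of the pairs \<open>{s, s + 1}\<close>,
  \<open>{s + 3, s + 4}\<close>, and so on; the vertex skipped between pairs keeps every choice
  independent. No skipped vertex is needed after the last pair, whence \<open>e + 1\<close>.\<close>

lemma path_obstructed:
  fixes w :: "nat \<Rightarrow> 'k::field"
  assumes "s + 3 * k \<le> e + 1"
  shows "obstructed w {S \<in> path_indep s e. card S = k}"
  using assms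
proof (induction k arbitrary: s)
  case 0
  have "{} \<in> path_indep s e"
    by (simp add: path_indep_def)
  then show ?case
    by (intro obstructed_mono[OF obstructed_empty_set]) auto
next
  case (Suc k)
  let ?X = "{S \<in> path_indep (s + 3) e. card S = k}"
  have "obstructed w ?X"
    by (rule Suc.IH) (use Suc.prems in simp)
  have X: "finite S \<and> s \<notin> S \<and> Suc s \<notin> S" if "S \<in> ?X" for S
    using that by (auto simp: path_indep_finite path_indep_def)
  have "obstructed w (insert s ` ?X \<union> insert (Suc s) ` ?X)"
    by (rule obstructed_insert_pair[OF \<open>obstructed w ?X\<close>]) (simp, erule X)
  moreover have "insert s ` ?X \<union> insert (Suc s) ` ?X \<subseteq> {S \<in> path_indep s e. card S = Suc k}"
  proof -
    have "insert i S \<in> path_indep s e \<and> card (insert i S) = Suc k"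
      if "S \<in> ?X" "i \<in> {s, Suc s}" for i S
    proof -
      have "insert i S \<in> path_indep s e"
        using that Suc.prems path_indep_mono[of S "s + 3" e "i + 2" e]
        by (intro path_indep_insert) auto
      then show ?thesis
        using that X[OF that(1)] by auto
    qed
    then show ?thesis
      by auto
  qed
  ultimately show ?case
    by (rule obstructed_mono)
qed

text \<open>One further pair, \<open>{0, 2}\<close>, precedes those on the path from
  \<open>4\<close>; its vertices have only \<open>1\<close> and \<open>3\<close> as
  neighbours.\<close>

lemma tadpole_obstructed:
  fixes w :: "nat \<Rightarrow> 'k::field"
  assumes "3 * k \<le> n + 1"
  shows "obstructed w {S \<in> tadpole_indep (4 + n). card S = Suc k}"
proof -
  let ?X = "{S \<in> path_indep 4 (4 + n). card S = k}"
  have X: "finite S \<and> 0 \<notin> S \<and> 2 \<notin> S" if "S \<in> ?X" for S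
    using that by (auto simp: path_indep_finite path_indep_def)
  have "obstructed w ?X"
    by (rule path_obstructed) (use assms in simp)
  then have "obstructed w (insert 0 ` ?X \<union> insert 2 ` ?X)"
    by (rule obstructed_insert_pair) (simp, erule X)
  moreover have "insert i S \<in> tadpole_indep (4 + n) \<and> card (insert i S) = Suc k"
    if "S \<in> ?X" "i \<in> {0, 2}" for i S
    using that X[OF that(1)] tadpole_indep_intros(2)[of "4 + n" S i] by auto
  then have "insert 0 ` ?X \<union> insert 2 ` ?X \<subseteq> {S \<in> tadpole_indep (4 + n). card S = Suc k}"
    by blast
  ultimately show ?thesis
    by (rule obstructed_mono)
qed

section \<open>The weak Lefschetz property\<close>

lemma tadpole_mult_inj:
  fixes l :: "'k::field_char_0 mpoly"
  assumes n: "n \<ge> 1" and l: "homog (4 + n) 1 l" "\<And>v. v < 4 + n \<Longrightarrow> linear_weight l v = 1"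
    and j: "4 * j \<le> n + 3"
  shows "mult_inj TYPE('k) (4 + n) (tadpole_edges 4 n) l j"
proof -
  interpret simple_graph "4 + n" "tadpole_edges 4 n"
    by (rule simple_graph_tadpole[OF n])
  have up: "raise (linear_weight l) F S = up F S" if "S \<in> tadpole_indep (4 + n)" for F S
    using that l(2) by (auto simp: raise_def tadpole_indep_def path_indep_def intro!: sum.cong)
  show ?thesis
    unfolding mult_inj_iff[OF l(1)] indep_sets_tadpole[OF n]
  proof (intro allI impI ballI)
    fix F S
    assume *: "\<forall>S\<in>{S \<in> tadpole_indep (4 + n). card S = Suc j}. raise (linear_weight l) F S = 0"
      and S: "S \<in> {S \<in> tadpole_indep (4 + n). card S = j}"
    show "F S = 0"
      by (rule tadpole_up_inj[of "4 + n" j F]) (use j S * up in auto)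
  qed
qed

lemma tadpole_mult_surj:
  fixes l :: "'k::field_char_0 mpoly"
  assumes n: "n \<ge> 1" and l: "homog (4 + n) 1 l" "\<And>v. v < 4 + n \<Longrightarrow> linear_weight l v = 1"
    and j: "n + 2 \<le> 3 * j"
  shows "mult_surj TYPE('k) (4 + n) (tadpole_edges 4 n) l j"
proof -
  interpret simple_graph "4 + n" "tadpole_edges 4 n"
    by (rule simple_graph_tadpole[OF n])
  have up: "raise (linear_weight l) F S = up F S" if "S \<in> tadpole_indep (4 + n)" for F S
    using that l(2) by (auto simp: raise_def tadpole_indep_def path_indep_def intro!: sum.cong)
  show ?thesis
    unfolding mult_surj_iff[OF l(1)] indep_sets_tadpole[OF n]
  proof
    fix G :: "nat set \<Rightarrow> 'k"
    have "\<exists>F. \<forall>S\<in>tadpole_indep (4 + n). card S = Suc j \<longrightarrow> up F S = G S"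
      by (rule tadpole_up_surj) (use n j in auto)
    then show "\<exists>F. \<forall>S\<in>{S \<in> tadpole_indep (4 + n). card S = Suc j}.
        raise (linear_weight l) F S = G S"
      by (auto simp: up)
  qed
qed

lemma exists_unit_linear_form:
  obtains l :: "'k::comm_ring_1 mpoly"
  where "homog N 1 l" "\<And>v. v < N \<Longrightarrow> linear_weight l v = 1"
proof -
  let ?A = "(\<lambda>v. {v}) ` {..<N}"
  let ?l = "set_poly ?A (\<lambda>_. 1 :: 'k)"
  have "linear_weight ?l v = 1" if "v < N" for v
  proof -
    have "Poly_Mapping.lookup ?l (set_monom {v}) = (if {v} \<in> ?A then 1 else 0)"
      by (rule lookup_set_poly) auto
    then show ?thesis
      using that by (simp add: linear_weight_def set_monom_def)
  qed
  moreover have "homog N 1 ?l"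
    by (rule homog_set_poly) auto
  ultimately show thesis
    using that by blast
qed

lemma tadpole_not_inj_not_surj:
  fixes l :: "'k::field mpoly"
  assumes n: "n \<ge> 1" and l: "homog (4 + n) 1 l" and j: "3 * j \<le> n + 1" "n + 4 \<le> 4 * j"
  shows "j < top_degree TYPE('k) (4 + n) (tadpole_edges 4 n)"
    "\<not> mult_inj TYPE('k) (4 + n) (tadpole_edges 4 n) l j"
    "\<not> mult_surj TYPE('k) (4 + n) (tadpole_edges 4 n) l j"
proof -
  interpret simple_graph "4 + n" "tadpole_edges 4 n"
    by (rule simple_graph_tadpole[OF n])
  have obs: "obstructed (linear_weight l) {S \<in> tadpole_indep (4 + n). card S = Suc j}"
    by (rule tadpole_obstructed[OF j(1)])
  then show "\<not> mult_surj TYPE('k) (4 + n) (tadpole_edges 4 n) l j"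
    unfolding mult_surj_iff[OF l] indep_sets_tadpole[OF n] obstructed_def by blast
  \<comment> \<open>An obstructed family is nonempty, so an independent set of size
    \<open>Suc j\<close> exists and \<open>j\<close> lies below the top degree.\<close>
  obtain S where "S \<in> tadpole_indep (4 + n)" "card S = Suc j"
    using obs unfolding obstructed_def by blast
  then show "j < top_degree TYPE('k) (4 + n) (tadpole_edges 4 n)"
    using card_le_top_degree[where 'k = 'k, of S] by (simp add: indep_sets_tadpole[OF n])
  have "3 * (j - 1) \<le> n" "n \<le> 4 * (j - 1)" "Suc (j - 1) = j"
    using j by linarith+
  then obtain F S where "\<forall>S\<in>tadpole_indep (4 + n). raise (linear_weight l) F S = 0"
    "S \<in> tadpole_indep (4 + n)" "card S = j" "F S \<noteq> 0"
    using tadpole_kernel[of "j - 1" n "linear_weight l"] by metis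
  then show "\<not> mult_inj TYPE('k) (4 + n) (tadpole_edges 4 n) l j"
    unfolding mult_inj_iff[OF l] indep_sets_tadpole[OF n] by blast
qed

section \<open>Arithmetic of the degrees where both properties fail\<close>

lemma no_gap_iff:
  assumes "n \<ge> 1"
  shows "(\<forall>j. 4 * j \<le> n + 3 \<or> n + 2 \<le> 3 * j) \<longleftrightarrow> n \<in> {1, 2, 3, 4, 5, 6, 7, 9, 10, 13::nat}"
proof
  assume "n \<in> {1, 2, 3, 4, 5, 6, 7, 9, 10, 13}"
  then show "\<forall>j. 4 * j \<le> n + 3 \<or> n + 2 \<le> 3 * j"
    by (elim insertE emptyE; simp; presburger)
next
  assume *: "\<forall>j. 4 * j \<le> n + 3 \<or> n + 2 \<le> 3 * j"
  \<comment> \<open>Of all \<open>j\<close> with \<open>3 * j \<le> n + 1\<close> this is the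
    largest, hence the hardest for \<open>4 * j \<le> n + 3\<close>. It bounds \<open>n\<close> and
    afterwards also excludes 8, 11, 12, 14 and 15.\<close>
  have "3 * ((n + 1) div 3) \<le> n + 1"
    by simp
  then have gap: "4 * ((n + 1) div 3) \<le> n + 3"
    using *[rule_format, of "(n + 1) div 3"] by linarith
  then have "n \<le> 15"
    by presburger
  with assms have "n = 1 \<or> n = 2 \<or> n = 3 \<or> n = 4 \<or> n = 5 \<or> n = 6 \<or> n = 7 \<or> n = 8 \<or>
      n = 9 \<or> n = 10 \<or> n = 11 \<or> n = 12 \<or> n = 13 \<or> n = 14 \<or> n = 15"
    by presburger
  then show "n \<in> {1, 2, 3, 4, 5, 6, 7, 9, 10, 13}"
    using gap by auto
qed

theorem theorem4p3:
  fixes n :: nat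
  assumes "n \<ge> 1"
  shows "has_WLP TYPE('k::field_char_0) (4 + n) (tadpole_edges 4 n)
           \<longleftrightarrow> n \<in> {1, 2, 3, 4, 5, 6, 7, 9, 10, 13}"
proof -
  \<comment> \<open>Here \<open>j\<close> may range over all naturals, since a \<open>j\<close>
    violating both inequalities lies below the top degree.\<close>
  have "has_WLP TYPE('k) (4 + n) (tadpole_edges 4 n) \<longleftrightarrow>
      (\<forall>j. 4 * j \<le> n + 3 \<or> n + 2 \<le> 3 * j)"
  proof
    assume wlp: "has_WLP TYPE('k) (4 + n) (tadpole_edges 4 n)"
    show "\<forall>j. 4 * j \<le> n + 3 \<or> n + 2 \<le> 3 * j"
    proof (rule ccontr)
      assume "\<not> (\<forall>j. 4 * j \<le> n + 3 \<or> n + 2 \<le> 3 * j)"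
      then obtain j where "\<not> 4 * j \<le> n + 3" "\<not> n + 2 \<le> 3 * j"
        by blast
      then have "3 * j \<le> n + 1" "n + 4 \<le> 4 * j"
        by linarith+
      then show False
        using wlp tadpole_not_inj_not_surj[where 'k = 'k, OF assms] unfolding has_WLP_def by blast
    qed
  next
    assume "\<forall>j. 4 * j \<le> n + 3 \<or> n + 2 \<le> 3 * j"
    moreover obtain l :: "'k mpoly"
      where "homog (4 + n) 1 l" "\<And>v. v < 4 + n \<Longrightarrow> linear_weight l v = 1"
      using exists_unit_linear_form by metis
    ultimately show "has_WLP TYPE('k) (4 + n) (tadpole_edges 4 n)"
      using tadpole_mult_inj[OF assms] tadpole_mult_surj[OF assms] unfolding has_WLP_def by blast
  qed
  then show ?thesis
    using no_gap_iff[OF assms] by simp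
qed

end
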